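(* Let $1\le m_0\le m$ be integers and let $G_0=\sum_{j=1}^{m_0}\pi_j\delta_{\theta_j}\in\mathcal{G}_{m_0}$ be a mixing distribution whose $m_0$-th support point $\theta_{m_0}$ lies in the interior of $\Theta$. Suppose that the family of densities $\{f(x,\theta),\theta\in\Theta\}$ with respect to $\lambda$ is $(p,q)$-smooth for all integers $1\le p\le 2(m-m_0+1)$ and $1\le q\le 4$, and that $$\int\left|f^{(2(m-m_0)+1)}(x,\theta_{m_0})\right|\,\mathrm{d}\lambda(x)>0 .$$ Then the optimal local minimax rate of estimation of a mixture around $G_0$ cannot be better than $n^{-1/(4(m-m_0)+2)}$, in the following sense: for any sequence of estimators $\hat G_n$ and any $\varepsilon>0$, $$\liminf_{n\to\infty}\ \sup_{\substack{G_1\in\mathcal{G}_m\\ W(G_1,G_0)<n^{-1/(4(m-m_0)+2)+\varepsilon}}} n^{1/(4(m-m_0)+2)}\ \mathbb{E}_{f(\cdot,G_1)^{\otimes n}}\,W(G_1,\hat G_n)>0 .$$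
   Context: $\Theta$ is a compact subset of $\mathbb{R}$ with non-empty interior, and $\{f(x,\theta)\}_{\theta\in\Theta}$ is a family of probability densities with respect to a $\sigma$-finite measure $\lambda$; $f^{(p)}(x,\theta)$ denotes the $p$-th derivative with respect to $\theta$. $\mathcal{G}_m$ is the set of probability measures on $\Theta$ supported on exactly $m$ points (mixing distributions with $m$ components), and $\mathcal{G}_{\le m}=\bigcup_{j=1}^m\mathcal{G}_j$. For a mixing distribution $G$, $f(x,G)=\int_\Theta f(x,\theta)\,\mathrm{d}G(\theta)$. $W$ is the $L^1$-Wasserstein metric $W(G_1,G_2)=\int_{\mathbb{R}}|G_1(-\infty,t]-G_2(-\infty,t]|\,\mathrm{d}t$. An estimator $\hat G_n$ is a (measurable) function of the sample $(X_1,\dots,X_n)$ with values in $\mathcal{G}_{\le m}$; $\mathbb{E}_{f(\cdot,G_1)^{\otimes n}}$ is the expectation when $X_1,\dots,X_n$ are i.i.d. with density $f(\cdot,G_1)$. $(p,q)$-smoothness: for $p\in\mathbb{N}$ and $q>0$ let $E_{p,q}:\Theta^3\to[0,\infty]$, $E_{p,q}(\theta_1,\theta_2,\theta_3)=\mathbb{E}_{\theta_1}\left|\frac{f^{(p)}(x,\theta_2)}{f(x,\theta_3)}\right|^q$, where $\mathbb{E}_{\theta_1}$ is the expectation when $x$ has density $f(\cdot,\theta_1)$. The family is $(p,q)$-smooth if $E_{p,q}$ is well-defined and continuous on $\Theta^3$, and there exists $\varepsilon>0$ such that for all $\theta_1$, $|\theta_2-\theta_3|<\varepsilon$ implies $E_{p,q}(\theta_1,\theta_2,\theta_3)<\infty$.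 *)

theory Defs
  imports "HOL-Probability.Probability"
begin

definition density_family :: "real set \<Rightarrow> 'a measure \<Rightarrow> ('a \<Rightarrow> real \<Rightarrow> real) \<Rightarrow> bool" where
  "density_family \<Theta> M f \<longleftrightarrow>
     (\<forall>\<theta>\<in>\<Theta>. (\<lambda>x. f x \<theta>) \<in> borel_measurable M \<and> (\<forall>x\<in>space M. 0 \<le> f x \<theta>)
            \<and> (\<integral>\<^sup>+x. ennreal (f x \<theta>) \<partial>M) = 1)"

text \<open>
  As in Taylor's theorem of the library, the derivatives are carried by a sequence: \<open>D p x\<close> is the
  \<open>p\<close>-th derivative of \<open>f x\<close> on \<open>\<Theta>\<close>, for \<open>p \<le> N\<close>. The densities are only given on \<open>\<Theta>\<close>, so derivatives
  are taken within \<open>\<Theta>\<close>: ordinary ones in the interior, one-sided ones at the ends of an interval.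
  At an isolated point of \<open>\<Theta>\<close> no value is prescribed.
\<close>
definition theta_derivs ::
    "real set \<Rightarrow> 'a measure \<Rightarrow> ('a \<Rightarrow> real \<Rightarrow> real) \<Rightarrow> (nat \<Rightarrow> 'a \<Rightarrow> real \<Rightarrow> real) \<Rightarrow> nat \<Rightarrow> bool" where
  "theta_derivs \<Theta> M f D N \<longleftrightarrow>
     (\<forall>x\<in>space M. \<forall>\<theta>\<in>\<Theta>. D 0 x \<theta> = f x \<theta> \<and>
        (\<forall>k<N. (D k x has_real_derivative D (Suc k) x \<theta>) (at \<theta> within \<Theta>)))"

definition ennpowr :: "ennreal \<Rightarrow> real \<Rightarrow> ennreal" where
  "ennpowr y q = (if y = \<top> then \<top> else ennreal (enn2real y powr q))"

text \<open>
  The quotient is formed in \<^typ>\<open>ennreal\<close>, where \<open>c / 0 = \<infinity>\<close> for \<open>c \<noteq> 0\<close> (not \<open>0\<close>, as on the reals)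
  and \<open>0 / 0 = 0\<close>. The exponent \<open>q\<close> is meant to be positive.
\<close>
definition E_pq ::
    "'a measure \<Rightarrow> ('a \<Rightarrow> real \<Rightarrow> real) \<Rightarrow> (nat \<Rightarrow> 'a \<Rightarrow> real \<Rightarrow> real) \<Rightarrow> nat \<Rightarrow> real
      \<Rightarrow> real \<Rightarrow> real \<Rightarrow> real \<Rightarrow> ennreal" where
  "E_pq M f D p q \<theta>1 \<theta>2 \<theta>3 =
     (\<integral>\<^sup>+x. ennpowr (ennreal \<bar>D p x \<theta>2\<bar> / ennreal (f x \<theta>3)) q
        \<partial>density M (\<lambda>x. ennreal (f x \<theta>1)))"

text \<open>Well-definedness of \<open>E_pq\<close> is existence of the \<open>p\<close>-th derivative and its measurability in \<open>x\<close>.\<close>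
definition pq_smooth ::
    "real set \<Rightarrow> 'a measure \<Rightarrow> ('a \<Rightarrow> real \<Rightarrow> real) \<Rightarrow> (nat \<Rightarrow> 'a \<Rightarrow> real \<Rightarrow> real) \<Rightarrow> nat \<Rightarrow> real
      \<Rightarrow> bool" where
  "pq_smooth \<Theta> M f D p q \<longleftrightarrow>
     theta_derivs \<Theta> M f D p \<and>
     (\<forall>\<theta>\<in>\<Theta>. (\<lambda>x. D p x \<theta>) \<in> borel_measurable M) \<and>
     continuous_on (\<Theta> \<times> \<Theta> \<times> \<Theta>) (\<lambda>(\<theta>1, \<theta>2, \<theta>3). E_pq M f D p q \<theta>1 \<theta>2 \<theta>3) \<and>
     (\<exists>\<epsilon>>0. \<forall>\<theta>1\<in>\<Theta>. \<forall>\<theta>2\<in>\<Theta>. \<forall>\<theta>3\<in>\<Theta>. \<bar>\<theta>2 - \<theta>3\<bar> < \<epsilon> \<longrightarrow> E_pq M f D p q \<theta>1 \<theta>2 \<theta>3 < \<infinity>)"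

text \<open>Finiteness is required separately because \<^const>\<open>card\<close> is \<open>0\<close> on infinite sets.\<close>
definition mixing :: "real set \<Rightarrow> nat \<Rightarrow> real pmf set" where
  "mixing \<Theta> m = {G. finite (set_pmf G) \<and> card (set_pmf G) = m \<and> set_pmf G \<subseteq> \<Theta>}"

definition mixing_le :: "real set \<Rightarrow> nat \<Rightarrow> real pmf set" where
  "mixing_le \<Theta> m = (\<Union>j\<in>{1..m}. mixing \<Theta> j)"

definition mix_density :: "('a \<Rightarrow> real \<Rightarrow> real) \<Rightarrow> 'a \<Rightarrow> real pmf \<Rightarrow> real" where
  "mix_density f x G = (\<integral>\<theta>. f x \<theta> \<partial>measure_pmf G)"

definition W :: "real pmf \<Rightarrow> real pmf \<Rightarrow> real" where
  "W G1 G2 = (\<integral>t. \<bar>measure_pmf.prob G1 {..t} - measure_pmf.prob G2 {..t}\<bar> \<partial>lborel)"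

definition sample_law ::
    "'a measure \<Rightarrow> ('a \<Rightarrow> real \<Rightarrow> real) \<Rightarrow> real pmf \<Rightarrow> nat \<Rightarrow> (nat \<Rightarrow> 'a) measure" where
  "sample_law M f G n = PiM {..<n} (\<lambda>_. density M (\<lambda>x. ennreal (mix_density f x G)))"

text \<open>
  Measurability refers to the \<open>\<sigma>\<close>-algebra generated by the evaluations \<open>G \<mapsto> G(A)\<close>, which on
  \<open>mixing_le \<Theta> m\<close> is the Borel \<open>\<sigma>\<close>-algebra of the metric \<open>W\<close>.
\<close>
definition estimator ::
    "real set \<Rightarrow> 'a measure \<Rightarrow> nat \<Rightarrow> nat \<Rightarrow> ((nat \<Rightarrow> 'a) \<Rightarrow> real pmf) \<Rightarrow> bool" where
  "estimator \<Theta> M m n T \<longleftrightarrow>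
     (\<forall>X\<in>space (PiM {..<n} (\<lambda>_. M)). T X \<in> mixing_le \<Theta> m) \<and>
     (\<forall>A\<in>sets borel. (\<lambda>X. measure_pmf.prob (T X) A) \<in> borel_measurable (PiM {..<n} (\<lambda>_. M)))"

end

theory Submission
  imports Defs
begin

text \<open>
  Le Cam's two-point method. Put \<open>k = 2 (m - m0) + 1\<close> and \<open>h\<close> proportional to \<open>n powr (- 1 / (2 k))\<close>, and
  split the atom \<open>t\<close> of \<open>G0\<close> with index \<open>m0\<close> into the points \<open>t + i h\<close> with weights proportional to
  \<open>k choose i\<close>, once over the even \<open>i \<le> k\<close> and once over the odd ones. Both mixtures have \<open>m\<close> atoms, are
  within \<open>O(h)\<close> of \<open>G0\<close>, and are at distance at least a multiple of \<open>h\<close> from each other. Their densities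
  differ by a \<open>k\<close>-th finite difference of \<open>f x\<close>, which is of order \<open>h ^ k\<close>; smoothness with \<open>q = 2\<close> turns
  this into a squared Hellinger distance of order \<open>h ^ (2 k) = O(1 / n)\<close>, so that \<open>n\<close> observations do not
  separate the two laws.
\<close>

section \<open>The Wasserstein distance between distribution functions\<close>

text \<open>The order k is the largest that m atoms allow. Put d = m - m0. Two laws with d + 1 atoms
  each occupy at most 2 d + 2 points, and a nonzero signed measure on so few points cannot
  annihilate all polynomials of degree at most 2 d + 1. The alternating binomial coefficients
  annihilate those of degree 2 d = k - 1, and k is odd, so both parities receive the same number d +
  1 of atoms.

  Smoothness controls derivatives only in the mean over x, at fixed parameters. A Taylor remainder
  at an intermediate point depending on x would therefore be out of reach; the remainder is kept as
  an integral over the parameter and Fubini is applied. This requires joint measurability of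
  \<open>D k x s\<close> in (x, s), recovered from measurability in x and continuity in s.

  A second obstacle is vanishing densities: \<open>E_pq\<close> at (a, s, a) gives no weight to the
  set where \<open>f x a = 0\<close>. The squared difference of the mixture densities p and q is
  therefore divided by p + q, which dominates a multiple of each \<open>f x (t + i h)\<close>; where
  p and q differ, at least one of these is positive.\<close>

lemma borel_measurable_right_continuous_pair:
  fixes g :: "'a \<Rightarrow> real \<Rightarrow> real"
  assumes meas: "\<And>t. (\<lambda>x. g x t) \<in> borel_measurable M"
    and cont: "\<And>x t. x \<in> space M \<Longrightarrow> continuous (at_right t) (g x)"
  shows "(\<lambda>(x, t). g x t) \<in> borel_measurable (M \<Otimes>\<^sub>M lborel)"
proof -
  \<comment> \<open>The grid point strictly to the right of \<open>t\<close> with mesh 1 / (N + 1).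
    The \<open>+ 1\<close> makes the inequality strict, as \<open>at_right t\<close> excludes
    \<open>t\<close> itself. For fixed \<open>N\<close> only countably many values occur, so
    measurability in \<open>x\<close> at each of them suffices.\<close>
  define s :: "nat \<Rightarrow> real \<Rightarrow> real"
    where "s N t = real_of_int (\<lfloor>real (Suc N) * t\<rfloor> + 1) / real (Suc N)" for N t
  show ?thesis
  proof (rule borel_measurable_LIMSEQ_metric)
    fix N
    have "(\<lambda>z. (\<lambda>i::int. \<lambda>z. g (fst z) (real_of_int (i + 1) / real (Suc N)))
        (\<lfloor>real (Suc N) * snd z\<rfloor>) z) \<in> borel_measurable (M \<Otimes>\<^sub>M (lborel :: real measure))"
      by (rule measurable_compose_countable)
         (auto intro!: measurable_compose[OF measurable_fst meas])
    then show "(\<lambda>(x, t). g x (s N t)) \<in> borel_measurable (M \<Otimes>\<^sub>M lborel)"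
      by (simp add: case_prod_beta' s_def)
  next
    fix z assume z: "z \<in> space (M \<Otimes>\<^sub>M (lborel :: real measure))"
    obtain x t where zxt: "z = (x, t)" by force
    have x: "x \<in> space M" using z zxt by (simp add: space_pair_measure)
    have gt: "t < s N t" for N
    proof -
      have "real (Suc N) * t < real_of_int (\<lfloor>real (Suc N) * t\<rfloor> + 1)" by linarith
      then show ?thesis by (simp add: s_def field_simps)
    qed
    have le: "s N t \<le> t + 1 / real (Suc N)" for N
    proof -
      have "real_of_int (\<lfloor>real (Suc N) * t\<rfloor> + 1) \<le> real (Suc N) * t + 1" by linarith
      then have "s N t \<le> (real (Suc N) * t + 1) / real (Suc N)"
        unfolding s_def by (rule divide_right_mono) simp
      then show ?thesis by (simp add: add_divide_distrib)
    qed
    have "(\<lambda>N. t + 1 / real (Suc N)) \<longlonglongrightarrow> t + 0"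
      by (intro tendsto_add tendsto_const LIMSEQ_Suc lim_1_over_n)
    then have lim: "(\<lambda>N. t + 1 / real (Suc N)) \<longlonglongrightarrow> t" by (simp only: add_0_right)
    have "(\<lambda>N. s N t) \<longlonglongrightarrow> t"
      by (rule real_tendsto_sandwich[OF _ _ tendsto_const lim])
         (intro always_eventually allI less_imp_le[OF gt] le)+
    then have "filterlim (\<lambda>N. s N t) (at_right t) sequentially"
      by (simp add: filterlim_at gt less_imp_neq[OF gt, symmetric])
    moreover have "(g x \<longlongrightarrow> g x t) (at_right t)"
      using cont[OF x] by (simp add: continuous_within)
    ultimately show "(\<lambda>N. (\<lambda>(x, t). g x (s N t)) z) \<longlonglongrightarrow> (\<lambda>(x, t). g x t) z"
      unfolding zxt prod.case by (rule filterlim_compose[rotated])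
  qed
qed

text \<open>Beyond the supports both distribution functions are 0 or both are 1, so the difference
  is a bounded function living on a bounded interval. This makes \<open>W\<close> a genuine integral
  rather than the default value 0 of a nonintegrable function.\<close>

lemma integrable_cdf_diff:
  fixes P Q :: "real pmf"
  assumes "bounded (set_pmf P)" and "bounded (set_pmf Q)"
  shows "integrable lborel (\<lambda>t. measure_pmf.prob P {..t} - measure_pmf.prob Q {..t})"
proof -
  obtain B where B: "\<And>x. x \<in> set_pmf P \<union> set_pmf Q \<Longrightarrow> \<bar>x\<bar> \<le> B"
    using assms by (metis bounded_Un bounded_real)
  have [measurable]: "(\<lambda>t. measure_pmf.prob R {..t}) \<in> borel_measurable borel" for R :: "real pmf"
    by (intro borel_measurable_mono monoI) (auto intro!: measure_pmf.finite_measure_mono)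
  have zero: "measure_pmf.prob R {..t} = 0" if "t < - B" "set_pmf R \<subseteq> set_pmf P \<union> set_pmf Q"
    for t and R :: "real pmf"
    using B that by (subst measure_pmf_zero_iff) (force simp: abs_le_iff)
  have one: "measure_pmf.prob R {..t} = 1" if "B < t" "set_pmf R \<subseteq> set_pmf P \<union> set_pmf Q"
    for t and R :: "real pmf"
    using B that by (subst measure_pmf.prob_eq_1) (force simp: AE_measure_pmf_iff abs_le_iff)+
  have bnd: "norm (measure_pmf.prob P {..t} - measure_pmf.prob Q {..t}) \<le> 1" for t
    using measure_pmf.prob_le_1[of P "{..t}"] measure_pmf.prob_le_1[of Q "{..t}"]
      measure_nonneg[of P "{..t}"] measure_nonneg[of Q "{..t}"]
    unfolding real_norm_def abs_le_iff by linarith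
  show ?thesis
  proof (rule integrableI_bounded_set[where A = "{- B..B}" and B = 1])
    show "(\<lambda>t. measure_pmf.prob P {..t} - measure_pmf.prob Q {..t}) \<in> borel_measurable lborel"
      by measurable
    show "AE t in lborel. t \<in> {- B..B} \<longrightarrow> norm (measure_pmf.prob P {..t} - measure_pmf.prob Q {..t}) \<le> 1"
      using bnd by auto
    show "AE t in lborel. t \<notin> {- B..B} \<longrightarrow> measure_pmf.prob P {..t} - measure_pmf.prob Q {..t} = 0"
      using zero[of _ P] zero[of _ Q] one[of _ P] one[of _ Q]
      by (intro AE_I2) (auto simp: not_le)
  qed (auto simp: emeasure_lborel_Icc_eq)
qed

lemma W_nonneg: "0 \<le> W P Q"
  unfolding W_def by (rule integral_nonneg_AE) simp

text \<open>\<open>R\<close> stands second in both terms because it will be the estimate, compared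
  with two candidate mixtures.\<close>

lemma W_triangle:
  assumes "bounded (set_pmf P)" and "bounded (set_pmf Q)" and "bounded (set_pmf R)"
  shows "W P Q \<le> W P R + W Q R"
proof -
  note int = integrable_abs[OF integrable_cdf_diff]
  have "W P R + W Q R = (\<integral>t. \<bar>measure_pmf.prob P {..t} - measure_pmf.prob R {..t}\<bar>
      + \<bar>measure_pmf.prob Q {..t} - measure_pmf.prob R {..t}\<bar> \<partial>lborel)"
    unfolding W_def using assms by (intro Bochner_Integration.integral_add[symmetric] int)
  also have "\<dots> \<ge> W P Q"
    unfolding W_def using assms by (intro integral_mono Bochner_Integration.integrable_add int) auto
  finally show ?thesis .
qed

text \<open>\<open>W\<close> is an integral over \<open>t\<close>, so its measurability follows from
  joint measurability of the integrand. Distribution functions are right continuous, hence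
  evaluations on half-lines are enough.\<close>

lemma borel_measurable_W:
  assumes "\<And>t. (\<lambda>x. measure_pmf.prob (T x) {..t}) \<in> borel_measurable N"
  shows "(\<lambda>x. W G (T x)) \<in> borel_measurable N"
proof -
  have rc: "continuous (at_right t) (\<lambda>t. measure_pmf.prob P {..t})" for t and P :: "real pmf"
  proof -
    interpret real_distribution "distr P borel (\<lambda>x. x)"
      by (rule prob_space.real_distribution_distr[OF measure_pmf.prob_space_axioms]) simp
    have "cdf (distr P borel (\<lambda>x. x)) = (\<lambda>t. measure_pmf.prob P {..t})"
      by (auto simp: fun_eq_iff cdf_def2 measure_distr)
    then show ?thesis using cdf_is_right_cont[of t] by simp
  qed
  have "(\<lambda>(x, t). \<bar>measure_pmf.prob G {..t} - measure_pmf.prob (T x) {..t}\<bar>)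
      \<in> borel_measurable (N \<Otimes>\<^sub>M lborel)"
  proof (rule borel_measurable_right_continuous_pair)
    show "(\<lambda>x. \<bar>measure_pmf.prob G {..t} - measure_pmf.prob (T x) {..t}\<bar>) \<in> borel_measurable N" for t
      using assms by simp
    show "continuous (at_right t) (\<lambda>t. \<bar>measure_pmf.prob G {..t} - measure_pmf.prob (T x) {..t}\<bar>)" for x t
      by (intro continuous_rabs continuous_diff rc)
  qed
  then show ?thesis
    unfolding W_def by (rule lborel.borel_measurable_lebesgue_integral)
qed

section \<open>Le Cam's two-point bound\<close>

text \<open>Both measures agree on rectangles, where the integral of a product factorizes. The bound
  \<open>fin\<close> makes \<open>density M g\<close> finite, hence sigma-finite, so that rectangles
  determine the product measure.\<close>

lemma PiM_density:
  assumes sf: "sigma_finite_measure M" and I: "finite I"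
    and [measurable]: "g \<in> borel_measurable M"
    and fin: "(\<integral>\<^sup>+x. g x \<partial>M) < \<infinity>"
  shows "PiM I (\<lambda>_. density M g) = density (PiM I (\<lambda>_. M)) (\<lambda>X. \<Prod>i\<in>I. g (X i))"
proof -
  interpret M: product_sigma_finite "\<lambda>_. M" using sf by (simp add: product_sigma_finite_def)
  have "finite_measure (density M g)"
    using fin by (intro finite_measureI) (auto simp: emeasure_density cong: nn_integral_cong)
  then interpret D: product_sigma_finite "\<lambda>_. density M g"
    by (simp add: product_sigma_finite_def finite_measure.axioms)
  show ?thesis
  proof (rule D.PiM_eqI[OF I, symmetric])
    show "sets (density (PiM I (\<lambda>_. M)) (\<lambda>X. \<Prod>i\<in>I. g (X i))) = sets (PiM I (\<lambda>_. density M g))"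
      by (simp cong: sets_PiM_cong)
    fix A assume "\<And>i. i \<in> I \<Longrightarrow> A i \<in> sets (density M g)"
    then have A: "\<And>i. i \<in> I \<Longrightarrow> A i \<in> sets M" by simp
    have ind: "(\<Prod>i\<in>I. g (X i)) * indicator (Pi\<^sub>E I A) X = (\<Prod>i\<in>I. g (X i) * indicator (A i) (X i))"
      if X: "X \<in> space (PiM I (\<lambda>_. M))" for X
    proof (cases "X \<in> Pi\<^sub>E I A")
      case True
      then show ?thesis by (auto intro!: prod.cong simp: PiE_iff)
    next
      case False
      then obtain i where "i \<in> I" "X i \<notin> A i" using False X by (auto simp: space_PiM PiE_def)
      then show ?thesis using False I by (auto intro!: prod_zero[symmetric] bexI[of _ i])
    qed
    have "emeasure (density (PiM I (\<lambda>_. M)) (\<lambda>X. \<Prod>i\<in>I. g (X i))) (Pi\<^sub>E I A)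
        = (\<integral>\<^sup>+X. (\<Prod>i\<in>I. g (X i)) * indicator (Pi\<^sub>E I A) X \<partial>PiM I (\<lambda>_. M))"
      using A I by (intro emeasure_density) (auto intro!: sets_PiM_I_finite)
    also have "\<dots> = (\<integral>\<^sup>+X. (\<Prod>i\<in>I. g (X i) * indicator (A i) (X i)) \<partial>PiM I (\<lambda>_. M))"
      by (intro nn_integral_cong ind)
    also have "\<dots> = (\<Prod>i\<in>I. \<integral>\<^sup>+x. g x * indicator (A i) x \<partial>M)"
      using A I by (intro M.product_nn_integral_prod) auto
    also have "\<dots> = (\<Prod>i\<in>I. emeasure (density M g) (A i))"
      using A by (intro prod.cong refl emeasure_density[symmetric]) auto
    finally show "emeasure (density (PiM I (\<lambda>_. M)) (\<lambda>X. \<Prod>i\<in>I. g (X i))) (Pi\<^sub>E I A)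
      = (\<Prod>i\<in>I. emeasure (density M g) (A i))" .
  qed
qed

text \<open>The harmonic mean r = 2 p q / (p + q) is at most the geometric mean, and (p - q)^2 / (p
  + q) = p + q - 2 r. Hence (p + q) / 2 exceeds sqrt (p q) by at most half of the symmetric
  chi-square integrand; integration gives the claim.\<close>

lemma hellinger_affinity_ge:
  fixes p q :: "'a \<Rightarrow> real"
  assumes [measurable]: "p \<in> borel_measurable M" "q \<in> borel_measurable M"
    and nn: "\<And>x. x \<in> space M \<Longrightarrow> 0 \<le> p x" "\<And>x. x \<in> space M \<Longrightarrow> 0 \<le> q x"
    and p1: "(\<integral>\<^sup>+x. ennreal (p x) \<partial>M) = 1" and q1: "(\<integral>\<^sup>+x. ennreal (q x) \<partial>M) = 1"
    and chi: "(\<integral>\<^sup>+x. ennreal ((p x - q x)\<^sup>2 / (p x + q x)) \<partial>M) \<le> ennreal c" and c: "0 \<le> c"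
  shows "ennreal (1 - c / 2) \<le> (\<integral>\<^sup>+x. ennreal (sqrt (p x * q x)) \<partial>M)"
proof -
  have pt: "p x / 2 + q x / 2 \<le> sqrt (p x * q x) + (p x - q x)\<^sup>2 / (p x + q x) / 2"
    if x: "x \<in> space M" for x
  proof (cases "p x + q x = 0")
    case True
    then show ?thesis using nn[OF x] by (auto simp: add_nonneg_eq_0_iff)
  next
    case False
    then have s: "0 < p x + q x" using nn[OF x] by linarith
    have "2 * sqrt (p x * q x) \<le> p x + q x"
      using arith_geo_mean_sqrt[OF nn[OF x]] by (simp add: field_simps)
    then have "sqrt (p x * q x) * (2 * sqrt (p x * q x)) \<le> sqrt (p x * q x) * (p x + q x)"
      using nn[OF x] by (intro mult_left_mono) auto
    moreover have "sqrt (p x * q x) * sqrt (p x * q x) = p x * q x"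
      using nn[OF x] by (intro real_sqrt_mult_self[THEN trans]) simp
    ultimately have "2 * (p x * q x) \<le> sqrt (p x * q x) * (p x + q x)"
      by (simp only: mult.left_commute[of _ 2])
    define r where "r = 2 * (p x * q x) / (p x + q x)"
    have "r \<le> sqrt (p x * q x)"
      unfolding r_def using s \<open>2 * (p x * q x) \<le> _\<close> by (simp add: pos_divide_le_eq)
    moreover have "(p x - q x)\<^sup>2 = (p x + q x) * (p x + q x) - 2 * (2 * (p x * q x))"
      by (simp add: power2_eq_square algebra_simps)
    then have "(p x - q x)\<^sup>2 / (p x + q x) = p x + q x - 2 * r"
      unfolding r_def using s by (simp add: diff_divide_distrib)
    ultimately show ?thesis by (simp only:) argo
  qed
  have half: "ennreal (1/2) + ennreal (1/2) = 1"
    by (subst ennreal_plus[symmetric]) simp_all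
  have "1 = (\<integral>\<^sup>+x. ennreal (1/2) * ennreal (p x) + ennreal (1/2) * ennreal (q x) \<partial>M)"
    by (simp only: half nn_integral_add nn_integral_cmult borel_measurable_times_ennreal measurable_compose[OF _ measurable_ennreal]
        borel_measurable_const assms(1,2) p1 q1 mult_1_right)
  also have "\<dots> \<le> (\<integral>\<^sup>+x. ennreal (sqrt (p x * q x)) + ennreal (1/2) * ennreal ((p x - q x)\<^sup>2 / (p x + q x)) \<partial>M)"
  proof (intro nn_integral_mono)
    fix x assume x: "x \<in> space M"
    have "ennreal (1/2) * ennreal (p x) + ennreal (1/2) * ennreal (q x) = ennreal (1/2 * p x + 1/2 * q x)"
      using nn[OF x] by (simp only: ennreal_plus ennreal_mult mult_nonneg_nonneg)
    also have "\<dots> \<le> ennreal (sqrt (p x * q x) + 1/2 * ((p x - q x)\<^sup>2 / (p x + q x)))"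
      using pt[OF x] by (intro ennreal_leI) (simp only: times_divide_eq_left mult_1_left)
    also have "\<dots> = ennreal (sqrt (p x * q x)) + ennreal (1/2) * ennreal ((p x - q x)\<^sup>2 / (p x + q x))"
    proof -
      have "0 \<le> sqrt (p x * q x)" "0 \<le> (1/2 :: real)" "0 \<le> (p x - q x)\<^sup>2 / (p x + q x)"
        using nn[OF x] by auto
      then show ?thesis by (simp only: ennreal_plus ennreal_mult mult_nonneg_nonneg)
    qed
    finally show "ennreal (1/2) * ennreal (p x) + ennreal (1/2) * ennreal (q x)
      \<le> ennreal (sqrt (p x * q x)) + ennreal (1/2) * ennreal ((p x - q x)\<^sup>2 / (p x + q x))" .
  qed
  also have "\<dots> = (\<integral>\<^sup>+x. ennreal (sqrt (p x * q x)) \<partial>M)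
      + ennreal (1/2) * (\<integral>\<^sup>+x. ennreal ((p x - q x)\<^sup>2 / (p x + q x)) \<partial>M)"
    by (simp add: nn_integral_add nn_integral_cmult)
  also have "\<dots> \<le> (\<integral>\<^sup>+x. ennreal (sqrt (p x * q x)) \<partial>M) + ennreal (1/2) * ennreal c"
    by (intro add_left_mono mult_left_mono chi) simp
  also have "ennreal (1/2) * ennreal c = ennreal (c / 2)"
    using c by (subst ennreal_mult[symmetric]) simp_all
  finally have "ennreal 1 \<le> (\<integral>\<^sup>+x. ennreal (sqrt (p x * q x)) \<partial>M) + ennreal (c / 2)" by simp
  then have "ennreal 1 - ennreal (c / 2) \<le> (\<integral>\<^sup>+x. ennreal (sqrt (p x * q x)) \<partial>M)"
    by (simp add: ennreal_minus_le_iff add.commute)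
  moreover have "0 \<le> c / 2" using c by simp
  \<comment> \<open>For \<open>c > 2\<close> both forms of the left side are 0, by truncated
    subtraction and by \<open>ennreal\<close> of a negative number.\<close>
  ultimately show ?thesis by (simp only: ennreal_minus)
qed

text \<open>
  For likelihoods \<open>a\<close> and \<open>b\<close>, \<open>sqrt (a b) = sqrt (min a b * max a b) \<le> 2 min a b + max a b / 8\<close>, so
  an affinity of at least \<open>3/4\<close> forces an overlap \<open>\<integral> min a b\<close> of at least \<open>1/4\<close>.
\<close>
lemma le_cam_two_points:
  fixes p q :: "'a \<Rightarrow> real" and u v :: "(nat \<Rightarrow> 'a) \<Rightarrow> real"
  assumes sf: "sigma_finite_measure M"
    and [measurable]: "p \<in> borel_measurable M" "q \<in> borel_measurable M"
    and nn: "\<And>x. x \<in> space M \<Longrightarrow> 0 \<le> p x" "\<And>x. x \<in> space M \<Longrightarrow> 0 \<le> q x"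
    and p1: "(\<integral>\<^sup>+x. ennreal (p x) \<partial>M) = 1" and q1: "(\<integral>\<^sup>+x. ennreal (q x) \<partial>M) = 1"
    and chi: "(\<integral>\<^sup>+x. ennreal ((p x - q x)\<^sup>2 / (p x + q x)) \<partial>M) \<le> ennreal c" and c: "0 \<le> c"
    and nc: "real n * c \<le> 1 / 2"
    and [measurable]: "u \<in> borel_measurable (PiM {..<n} (\<lambda>_. M))" "v \<in> borel_measurable (PiM {..<n} (\<lambda>_. M))"
    and uv: "\<And>X. X \<in> space (PiM {..<n} (\<lambda>_. M)) \<Longrightarrow> w \<le> u X + v X" "0 \<le> w"
      "\<And>X. X \<in> space (PiM {..<n} (\<lambda>_. M)) \<Longrightarrow> 0 \<le> u X" "\<And>X. X \<in> space (PiM {..<n} (\<lambda>_. M)) \<Longrightarrow> 0 \<le> v X"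
  shows "ennreal (w / 4) \<le> (\<integral>\<^sup>+X. ennreal (u X) \<partial>PiM {..<n} (\<lambda>_. density M (\<lambda>x. ennreal (p x))))
      + (\<integral>\<^sup>+X. ennreal (v X) \<partial>PiM {..<n} (\<lambda>_. density M (\<lambda>x. ennreal (q x))))"
proof -
  interpret M: product_sigma_finite "\<lambda>_. M" using sf by (simp add: product_sigma_finite_def)
  let ?N = "PiM {..<n} (\<lambda>_. M)"
  define a where "a X = (\<Prod>i<n. p (X i))" for X
  define b where "b X = (\<Prod>i<n. q (X i))" for X
  have [measurable]: "a \<in> borel_measurable ?N" "b \<in> borel_measurable ?N"
    unfolding a_def b_def by measurable
  have Xi: "X i \<in> space M" if "X \<in> space ?N" "i < n" for X i
    using that by (auto simp: space_PiM PiE_iff)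
  have ab: "0 \<le> a X" "0 \<le> b X" if "X \<in> space ?N" for X
    unfolding a_def b_def using nn Xi[OF that] by (auto intro!: prod_nonneg)
  have eq: "(\<Prod>i<n. ennreal (r (X i))) = ennreal (\<Prod>i<n. r (X i))"
    if "X \<in> space ?N" "\<And>x. x \<in> space M \<Longrightarrow> 0 \<le> r x" for X and r :: "'a \<Rightarrow> real"
    using that Xi[OF that(1)] by (intro prod_ennreal) auto
  have prodint: "(\<integral>\<^sup>+X. ennreal (\<Prod>i<n. r (X i)) \<partial>?N) = (\<integral>\<^sup>+x. ennreal (r x) \<partial>M) ^ n"
    if [measurable]: "r \<in> borel_measurable M" and "\<And>x. x \<in> space M \<Longrightarrow> 0 \<le> r x" for r
  proof -
    have "(\<integral>\<^sup>+X. ennreal (\<Prod>i<n. r (X i)) \<partial>?N) = (\<integral>\<^sup>+X. (\<Prod>i<n. ennreal (r (X i))) \<partial>?N)"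
      using eq that(2) by (intro nn_integral_cong) simp
    also have "\<dots> = (\<integral>\<^sup>+x. ennreal (r x) \<partial>M) ^ n"
      by (subst M.product_nn_integral_prod) auto
    finally show ?thesis .
  qed
  have inta: "(\<integral>\<^sup>+X. ennreal (a X) \<partial>?N) = 1" and intb: "(\<integral>\<^sup>+X. ennreal (b X) \<partial>?N) = 1"
    unfolding a_def b_def using nn p1 q1 by (simp_all add: prodint)
  \<comment> \<open>The affinity is multiplicative over the sample, and Bernoulli's inequality gives
    (1 - c/2)^n >= 1 - n c / 2 >= 3/4. The case \<open>n = 0\<close> is separate because
    \<open>nc\<close> then puts no bound on \<open>c\<close>; the empty product has affinity
    1.\<close>
  have aff: "ennreal (3/4) \<le> (\<integral>\<^sup>+X. ennreal (sqrt (a X * b X)) \<partial>?N)"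
  proof (cases "n = 0")
    case True
    then show ?thesis by (simp add: a_def b_def PiM_empty nn_integral_count_space_finite)
  next
    case False
    then have "c \<le> real n * c" using c by (simp add: mult_le_cancel_right1)
    then have c2: "c \<le> 1/2" using nc by linarith
    have sqrt_prod: "(\<Prod>i\<in>S. sqrt (r i)) = sqrt (\<Prod>i\<in>S. r i)" for r :: "nat \<Rightarrow> real" and S
      by (induction S rule: infinite_finite_induct) (auto simp: real_sqrt_mult)
    have "3/4 \<le> 1 + real n * (- c / 2)" using nc by (simp add: field_simps)
    also have "\<dots> \<le> (1 + (- c / 2)) ^ n" using c2 by (intro Bernoulli_inequality) auto
    finally have "ennreal (3/4) \<le> ennreal (1 - c / 2) ^ n"
      using c2 by (simp add: ennreal_power ennreal_leI)
    also have "\<dots> \<le> (\<integral>\<^sup>+x. ennreal (sqrt (p x * q x)) \<partial>M) ^ n"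
      using hellinger_affinity_ge[OF assms(2-7) chi c] by (intro power_mono) auto
    also have "\<dots> = (\<integral>\<^sup>+X. ennreal (\<Prod>i<n. sqrt (p (X i) * q (X i))) \<partial>?N)"
      using nn by (intro prodint[symmetric]) auto
    also have "(\<lambda>X. \<Prod>i<n. sqrt (p (X i) * q (X i))) = (\<lambda>X. sqrt (a X * b X))"
      unfolding a_def b_def prod.distrib[symmetric] by (simp add: sqrt_prod)
    finally show ?thesis .
  qed
  have sq: "sqrt (x * y) \<le> 2 * min x y + x / 8 + y / 8" if "0 \<le> x" "0 \<le> y" for x y :: real
  proof -
    have "sqrt (x * y) = sqrt ((4 * min x y) * (max x y / 4))"
      by (auto simp: min_def max_def)
    also have "\<dots> \<le> (4 * min x y + max x y / 4) / 2"
      using that by (intro arith_geo_mean_sqrt) auto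
    also have "\<dots> \<le> 2 * min x y + x / 8 + y / 8" using that by (auto simp: min_def max_def)
    finally show ?thesis .
  qed
  have "ennreal (sqrt (a X * b X)) \<le> ennreal 2 * ennreal (min (a X) (b X))
      + (ennreal (1/8) * ennreal (a X) + ennreal (1/8) * ennreal (b X))" if "X \<in> space ?N" for X
  proof -
    have "ennreal (sqrt (a X * b X)) \<le> ennreal (2 * min (a X) (b X) + (1/8 * a X + 1/8 * b X))"
      using sq[OF ab[OF that]] by (intro ennreal_leI) simp
    also have "\<dots> = ennreal 2 * ennreal (min (a X) (b X))
      + (ennreal (1/8) * ennreal (a X) + ennreal (1/8) * ennreal (b X))"
      using ab[OF that] by (simp only: ennreal_plus ennreal_mult min.boundedI mult_nonneg_nonneg add_nonneg_nonneg)
    finally show ?thesis .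
  qed
  then have "ennreal (3/4) \<le> (\<integral>\<^sup>+X. ennreal 2 * ennreal (min (a X) (b X))
      + (ennreal (1/8) * ennreal (a X) + ennreal (1/8) * ennreal (b X)) \<partial>?N)"
    by (intro order.trans[OF aff] nn_integral_mono)
  also have "\<dots> = ennreal 2 * (\<integral>\<^sup>+X. ennreal (min (a X) (b X)) \<partial>?N) + ennreal (1/4)"
    by (simp add: nn_integral_add nn_integral_cmult inta intb flip: ennreal_plus)
  \<comment> \<open>The two terms with factor 1/8 integrate to 1/8 each, since \<open>a\<close> and
    \<open>b\<close> are probability densities.\<close>
  finally have "ennreal (3/4) - ennreal (1/4) \<le> ennreal 2 * (\<integral>\<^sup>+X. ennreal (min (a X) (b X)) \<partial>?N)"
    by (simp add: ennreal_minus_le_iff add.commute)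
  then have "ennreal (1/2) * ennreal (1/2) \<le> ennreal (1/2) * (ennreal 2 * (\<integral>\<^sup>+X. ennreal (min (a X) (b X)) \<partial>?N))"
    by (intro mult_left_mono) (simp_all add: ennreal_minus)
  moreover have "ennreal (1/2) * ennreal 2 = 1" "ennreal (1/2) * ennreal (1/2) = ennreal (1/4)"
    by (simp_all only: ennreal_mult'[symmetric]) simp_all
  ultimately have overlap: "ennreal (1/4) \<le> (\<integral>\<^sup>+X. ennreal (min (a X) (b X)) \<partial>?N)"
    by (simp only: mult.assoc[symmetric] mult_1_left)
  have dens: "(\<integral>\<^sup>+X. ennreal (h X) \<partial>PiM {..<n} (\<lambda>_. density M (\<lambda>x. ennreal (r x))))
      = (\<integral>\<^sup>+X. ennreal (\<Prod>i<n. r (X i)) * ennreal (h X) \<partial>?N)"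
    if [measurable]: "r \<in> borel_measurable M" "h \<in> borel_measurable ?N"
      and "\<And>x. x \<in> space M \<Longrightarrow> 0 \<le> r x" "(\<integral>\<^sup>+x. ennreal (r x) \<partial>M) = 1" for r h
  proof -
    have "(\<integral>\<^sup>+X. ennreal (h X) \<partial>PiM {..<n} (\<lambda>_. density M (\<lambda>x. ennreal (r x))))
        = (\<integral>\<^sup>+X. (\<Prod>i<n. ennreal (r (X i))) * ennreal (h X) \<partial>?N)"
      using that(4) by (subst PiM_density[OF sf]) (auto simp: nn_integral_density)
    then show ?thesis using that(3) by (simp add: eq cong: nn_integral_cong)
  qed
  have "ennreal (w / 4) = ennreal w * ennreal (1/4)" using uv(2) by (simp add: ennreal_mult'[symmetric])
  also have "\<dots> \<le> ennreal w * (\<integral>\<^sup>+X. ennreal (min (a X) (b X)) \<partial>?N)"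
    by (intro mult_left_mono overlap) simp
  also have "\<dots> = (\<integral>\<^sup>+X. ennreal w * ennreal (min (a X) (b X)) \<partial>?N)"
    by (simp add: nn_integral_cmult)
  also have "\<dots> \<le> (\<integral>\<^sup>+X. ennreal (a X) * ennreal (u X) + ennreal (b X) * ennreal (v X) \<partial>?N)"
  proof (intro nn_integral_mono)
    fix X assume X: "X \<in> space ?N"
    \<comment> \<open>On the overlap of the two likelihoods the same sample has to serve both laws,
      and there the losses \<open>u\<close> and \<open>v\<close> add up to at least
      \<open>w\<close>.\<close>
    have "w * min (a X) (b X) \<le> (u X + v X) * min (a X) (b X)"
      using uv(1)[OF X] ab[OF X] by (intro mult_right_mono) auto
    also have "\<dots> \<le> u X * a X + v X * b X"
      unfolding distrib_right using uv(3,4)[OF X] by (intro add_mono mult_left_mono) auto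
    finally show "ennreal w * ennreal (min (a X) (b X)) \<le> ennreal (a X) * ennreal (u X) + ennreal (b X) * ennreal (v X)"
      using uv(2) uv(3,4)[OF X] ab[OF X]
      by (simp add: ennreal_mult'[symmetric] ennreal_leI mult.commute flip: ennreal_plus)
  qed
  also have "\<dots> = (\<integral>\<^sup>+X. ennreal (u X) \<partial>PiM {..<n} (\<lambda>_. density M (\<lambda>x. ennreal (p x))))
      + (\<integral>\<^sup>+X. ennreal (v X) \<partial>PiM {..<n} (\<lambda>_. density M (\<lambda>x. ennreal (q x))))"
    using nn p1 q1 by (simp add: dens nn_integral_add a_def b_def)
  finally show ?thesis .
qed

section \<open>Finite differences\<close>

text \<open>Pascal's rule: a difference of order k + 1 is a difference of order k of first
  differences. This is the induction step for the bounds below.\<close>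

lemma alternating_choose_sum_Suc:
  fixes \<phi> :: "nat \<Rightarrow> real"
  shows "(\<Sum>i\<le>Suc k. (- 1) ^ i * real (Suc k choose i) * \<phi> i)
    = (\<Sum>i\<le>k. (- 1) ^ i * real (k choose i) * (\<phi> i - \<phi> (Suc i)))"
proof -
  have "(\<Sum>i\<le>Suc k. (- 1) ^ i * real (Suc k choose i) * \<phi> i)
      = \<phi> 0 + (\<Sum>i\<le>k. (- 1) ^ Suc i * real (k choose Suc i) * \<phi> (Suc i))
        + (\<Sum>i\<le>k. (- 1) ^ Suc i * real (k choose i) * \<phi> (Suc i))"
    by (subst sum.atMost_Suc_shift) (simp add: sum.distrib[symmetric] algebra_simps)
  also have "\<phi> 0 + (\<Sum>i\<le>k. (- 1) ^ Suc i * real (k choose Suc i) * \<phi> (Suc i))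
      = (\<Sum>i\<le>Suc k. (- 1) ^ i * real (k choose i) * \<phi> i)"
    by (subst sum.atMost_Suc_shift) simp
  also have "\<dots> = (\<Sum>i\<le>k. (- 1) ^ i * real (k choose i) * \<phi> i)"
    by simp
  finally show ?thesis by (simp add: sum_negf sum_subtractf right_diff_distrib)
qed

lemma DERIV_within_translate:
  fixes g :: "real \<Rightarrow> real"
  assumes "(g has_real_derivative d) (at (s + h) within B)" and "\<And>x. x \<in> A \<Longrightarrow> x + h \<in> B"
  shows "((\<lambda>x. g (x + h)) has_real_derivative d) (at s within A)"
proof -
  have "(g has_real_derivative d) (at (s + h) within (\<lambda>x. x + h) ` A)"
    using assms by (intro DERIV_subset[OF assms(1)]) auto
  moreover have "((\<lambda>x. x + h) has_real_derivative 1) (at s within A)"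
    by (auto intro!: derivative_eq_intros)
  ultimately show ?thesis using DERIV_image_chain[of g d "\<lambda>x. x + h" s A 1] by (simp add: o_def)
qed

text \<open>Each order gains one factor \<open>h\<close>. The induction passes to the family
  \<open>g j s - g j (s + h)\<close>, again linked by differentiation, on an interval shorter by
  \<open>h\<close>; indexing \<open>g\<close> by the order lets the hypothesis apply to this
  family.\<close>

lemma finite_difference_le:
  fixes g :: "nat \<Rightarrow> real \<Rightarrow> real"
  assumes h: "0 \<le> h"
    and der: "\<And>j s. j < k \<Longrightarrow> s \<in> {y..y + real k * h} \<Longrightarrow>
      (g j has_real_derivative g (Suc j) s) (at s within {y..y + real k * h})"
    and bnd: "\<And>s. s \<in> {y..y + real k * h} \<Longrightarrow> \<bar>g k s\<bar> \<le> B"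
  shows "\<bar>\<Sum>i\<le>k. (- 1) ^ i * real (k choose i) * g 0 (y + real i * h)\<bar> \<le> h ^ k * B"
  using der bnd
proof (induction k arbitrary: g B)
  case 0
  then show ?case by simp
next
  case (Suc k)
  let ?S = "{y..y + real (Suc k) * h}" and ?R = "{y..y + real k * h}"
  have sub: "s \<in> ?S" "s + h \<in> ?S" if "s \<in> ?R" for s
    using that h by (auto simp: distrib_right intro: add_increasing)
  have RS: "?R \<subseteq> ?S" using sub by blast
  have "\<bar>\<Sum>i\<le>k. (- 1) ^ i * real (k choose i) * (g 0 (y + real i * h) - g 0 (y + real i * h + h))\<bar>
      \<le> h ^ k * (B * h)"
  proof (rule Suc.IH[of "\<lambda>j s. g j s - g j (s + h)"])
    fix j s assume "j < k" "s \<in> ?R"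
    then show "((\<lambda>s. g j s - g j (s + h)) has_real_derivative g (Suc j) s - g (Suc j) (s + h)) (at s within ?R)"
      by (intro DERIV_diff[OF DERIV_subset[OF Suc.prems(1)] DERIV_within_translate[OF Suc.prems(1)]])
         (use sub RS in \<open>auto simp del: atLeastAtMost_iff of_nat_Suc atLeastatMost_subset_iff\<close>)
  next
    fix s assume s: "s \<in> ?R"
    \<comment> \<open>The mean value inequality turns the bound \<open>B\<close> on
      \<open>g (Suc k)\<close> into the bound \<open>B * h\<close> on the top derivative of the new
      family.\<close>
    have "norm (g k s - g k (s + h)) \<le> B * norm (s - (s + h))"
      using Suc.prems sub[OF s] by (intro field_differentiable_bound[of ?S]) auto
    then show "\<bar>g k s - g k (s + h)\<bar> \<le> B * h" using h by simp
  qed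
  also have "(\<Sum>i\<le>k. (- 1) ^ i * real (k choose i) * (g 0 (y + real i * h) - g 0 (y + real i * h + h)))
      = (\<Sum>i\<le>Suc k. (- 1) ^ i * real (Suc k choose i) * g 0 (y + real i * h))"
    by (subst alternating_choose_sum_Suc) (simp add: algebra_simps)
  finally show ?case by (simp add: mult_ac)
qed

text \<open>The last of the k + 1 differences is expressed by the fundamental theorem of calculus.
  The integral of the top derivative replaces its supremum, which would not be controlled by moments
  taken at fixed parameters.\<close>

lemma finite_difference_le_integral:
  fixes g :: "nat \<Rightarrow> real \<Rightarrow> real"
  assumes h: "0 \<le> h"
    and der: "\<And>j s. j \<le> k \<Longrightarrow> s \<in> {y..y + real (Suc k) * h} \<Longrightarrow>
      (g j has_real_derivative g (Suc j) s) (at s within {y..y + real (Suc k) * h})"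
    and cont: "continuous_on {y..y + real (Suc k) * h} (g (Suc k))"
  shows "\<bar>\<Sum>i\<le>Suc k. (- 1) ^ i * real (Suc k choose i) * g 0 (y + real i * h)\<bar>
    \<le> h ^ k * integral {y..y + real (Suc k) * h} (\<lambda>s. \<bar>g (Suc k) s\<bar>)"
proof -
  let ?S = "{y..y + real (Suc k) * h}" and ?R = "{y..y + real k * h}"
  have sub: "s \<in> ?S" "s + h \<in> ?S" if "s \<in> ?R" for s
    using that h by (auto simp: distrib_right intro: add_increasing)
  have RS: "?R \<subseteq> ?S" using sub by blast
  have "\<bar>\<Sum>i\<le>k. (- 1) ^ i * real (k choose i) * (g 0 (y + real i * h) - g 0 (y + real i * h + h))\<bar>
      \<le> h ^ k * integral ?S (\<lambda>s. \<bar>g (Suc k) s\<bar>)"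
  proof (rule finite_difference_le[OF h, of k y "\<lambda>j s. g j s - g j (s + h)"])
    fix j s assume "j < k" "s \<in> ?R"
    then show "((\<lambda>s. g j s - g j (s + h)) has_real_derivative g (Suc j) s - g (Suc j) (s + h)) (at s within ?R)"
      by (intro DERIV_diff[OF DERIV_subset[OF der] DERIV_within_translate[OF der]])
         (use sub RS in \<open>auto simp del: atLeastAtMost_iff of_nat_Suc atLeastatMost_subset_iff\<close>)
  next
    fix s assume s: "s \<in> ?R"
    have S: "{s..s + h} \<subseteq> ?S" using sub[OF s] by auto
    have int: "(\<lambda>s. \<bar>g (Suc k) s\<bar>) integrable_on ?S"
      using cont by (intro integrable_continuous_real continuous_intros)
    have "(g (Suc k) has_integral (g k (s + h) - g k s)) {s..s + h}"
    proof (rule fundamental_theorem_of_calculus)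
      fix x assume "x \<in> {s..s + h}"
      then show "(g k has_vector_derivative g (Suc k) x) (at x within {s..s + h})"
        unfolding has_real_derivative_iff_has_vector_derivative[symmetric]
        by (intro DERIV_subset[OF der[OF order_refl] S]) (use S in blast)
    qed (use h in simp)
    then have "g k (s + h) - g k s = integral {s..s + h} (g (Suc k))"
      by (simp add: integral_unique)
    then have "\<bar>g k s - g k (s + h)\<bar> = norm (integral {s..s + h} (g (Suc k)))" by simp
    also have "\<dots> \<le> integral {s..s + h} (\<lambda>s. \<bar>g (Suc k) s\<bar>)"
      using S cont by (intro integral_norm_bound_integral integrable_continuous_real
          continuous_intros continuous_on_subset[OF cont]) auto
    also have "\<dots> \<le> integral ?S (\<lambda>s. \<bar>g (Suc k) s\<bar>)"
      using S int by (intro integral_subset_le integrable_on_subinterval[OF int]) auto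
    finally show "\<bar>g k s - g k (s + h)\<bar> \<le> integral ?S (\<lambda>s. \<bar>g (Suc k) s\<bar>)" .
  qed
  also have "(\<Sum>i\<le>k. (- 1) ^ i * real (k choose i) * (g 0 (y + real i * h) - g 0 (y + real i * h + h)))
      = (\<Sum>i\<le>Suc k. (- 1) ^ i * real (Suc k choose i) * g 0 (y + real i * h))"
    by (subst alternating_choose_sum_Suc) (simp add: algebra_simps)
  finally show ?thesis .
qed

text \<open>Cauchy-Schwarz against the indicator of the interval. The length \<open>b - a\<close>
  contributes one further power of \<open>h\<close>; integrating out the parameter later contributes
  another.\<close>

lemma power2_integral_abs_le:
  fixes g :: "real \<Rightarrow> real"
  assumes "a \<le> b" and cont: "continuous_on {a..b} g"
  shows "ennreal ((integral {a..b} (\<lambda>s. \<bar>g s\<bar>))\<^sup>2)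
    \<le> ennreal (b - a) * (\<integral>\<^sup>+s. ennreal ((g s)\<^sup>2) * indicator {a..b} s \<partial>lborel)"
proof -
  let ?I = "indicator {a..b} :: real \<Rightarrow> ennreal"
  \<comment> \<open>Only continuity on \<open>{a..b}\<close> is known, so measurability is available
    for the product with the indicator.\<close>
  have [measurable]: "(\<lambda>s. ennreal \<bar>g s\<bar> * ?I s) \<in> borel_measurable lborel"
  proof -
    have "(\<lambda>s. ennreal \<bar>indicator {a..b} s *\<^sub>R g s\<bar>) \<in> borel_measurable borel"
      using borel_measurable_continuous_on_indicator[OF _ cont] by simp
    also have "(\<lambda>s. ennreal \<bar>indicator {a..b} s *\<^sub>R g s\<bar>) = (\<lambda>s. ennreal \<bar>g s\<bar> * ?I s)"
      by (auto simp: fun_eq_iff indicator_def)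
    finally show ?thesis by simp
  qed
  have sq: "(ennreal \<bar>g s\<bar> * ?I s)\<^sup>2 = ennreal ((g s)\<^sup>2) * ?I s" "ennreal \<bar>g s\<bar> * ?I s * ?I s = ennreal \<bar>g s\<bar> * ?I s"
     "(?I s)\<^sup>2 = ?I s" for s
    by (auto simp: ennreal_power indicator_def)
  have "((\<lambda>s. \<bar>g s\<bar>) has_integral integral {a..b} (\<lambda>s. \<bar>g s\<bar>)) {a..b}"
    using cont by (intro integrable_integral integrable_continuous_real continuous_intros)
  then have "ennreal (integral {a..b} (\<lambda>s. \<bar>g s\<bar>)) = (\<integral>\<^sup>+s. ennreal \<bar>g s\<bar> * ?I s \<partial>lborel)"
    by (subst nn_integral_has_integral_lebesgue') auto
  moreover have "0 \<le> integral {a..b} (\<lambda>s. \<bar>g s\<bar>)"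
    using cont by (intro Henstock_Kurzweil_Integration.integral_nonneg integrable_continuous_real continuous_intros) auto
  ultimately have "ennreal ((integral {a..b} (\<lambda>s. \<bar>g s\<bar>))\<^sup>2) = (\<integral>\<^sup>+s. ennreal \<bar>g s\<bar> * ?I s \<partial>lborel)\<^sup>2"
    by (simp add: ennreal_power[symmetric])
  also have "\<dots> \<le> (\<integral>\<^sup>+s. ennreal ((g s)\<^sup>2) * ?I s \<partial>lborel) * (\<integral>\<^sup>+s. ?I s \<partial>lborel)"
    using Cauchy_Schwarz_nn_integral[of "\<lambda>s. ennreal \<bar>g s\<bar> * ?I s" lborel ?I] by (simp add: sq)
  also have "(\<integral>\<^sup>+s. ?I s \<partial>lborel) = ennreal (b - a)"
    using \<open>a \<le> b\<close> by simp
  finally show ?thesis by (simp add: mult.commute)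
qed

section \<open>Splitting an atom\<close>

text \<open>An atom and an index are drawn independently, and the index acts only when the atom is
  \<open>t\<close>. As an image of a product law, the result is a \<open>pmf\<close> by
  construction.\<close>

definition split_atom :: "real \<Rightarrow> real \<Rightarrow> nat pmf \<Rightarrow> real pmf \<Rightarrow> real pmf" where
  "split_atom t h \<mu> G = map_pmf (\<lambda>(s, i). if s = t then t + real i * h else s) (pair_pmf G \<mu>)"

lemma set_pmf_split_atom:
  assumes "t \<in> set_pmf G"
  shows "set_pmf (split_atom t h \<mu> G) = (set_pmf G - {t}) \<union> (\<lambda>i. t + real i * h) ` set_pmf \<mu>"
proof -
  let ?f = "\<lambda>(s, i). if s = t then t + real i * h else s"
  obtain i where i: "i \<in> set_pmf \<mu>" using set_pmf_not_empty by fast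
  have "?f ` (set_pmf G \<times> set_pmf \<mu>) \<subseteq> (set_pmf G - {t}) \<union> (\<lambda>i. t + real i * h) ` set_pmf \<mu>"
    by (auto split: if_splits)
  moreover have "x \<in> ?f ` (set_pmf G \<times> set_pmf \<mu>)" if "x \<in> set_pmf G - {t}" for x
    using i that by (intro image_eqI[of _ _ "(x, i)"]) auto
  moreover have "t + real i * h \<in> ?f ` (set_pmf G \<times> set_pmf \<mu>)" if "i \<in> set_pmf \<mu>" for i
    using assms that by (intro image_eqI[of _ _ "(t, i)"]) auto
  ultimately have "?f ` (set_pmf G \<times> set_pmf \<mu>) = (set_pmf G - {t}) \<union> (\<lambda>i. t + real i * h) ` set_pmf \<mu>"
    by blast
  then show ?thesis by (simp add: split_atom_def)
qed

lemma integral_split_atom: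
  fixes \<phi> :: "real \<Rightarrow> real"
  assumes fin: "finite (set_pmf G)" and k: "set_pmf \<mu> \<subseteq> {..k}"
  shows "(\<integral>s. \<phi> s \<partial>split_atom t h \<mu> G)
    = (\<Sum>s\<in>set_pmf G - {t}. pmf G s * \<phi> s) + pmf G t * (\<Sum>i\<le>k. pmf \<mu> i * \<phi> (t + real i * h))"
proof -
  have one: "(\<Sum>i\<le>k. pmf \<mu> i) = 1" using k by (intro sum_pmf_eq_1) auto
  have "(\<integral>s. \<phi> s \<partial>split_atom t h \<mu> G)
      = (\<integral>z. \<phi> (case z of (s, i) \<Rightarrow> if s = t then t + real i * h else s) \<partial>pair_pmf G \<mu>)"
    unfolding split_atom_def by (rule integral_map_pmf)
  \<comment> \<open>Inserting \<open>t\<close> also covers the case that it is no atom of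
    \<open>G\<close>; its weight is then 0.\<close>
  also have "\<dots> = (\<Sum>(s, i)\<in>insert t (set_pmf G) \<times> {..k}.
      pmf G s * pmf \<mu> i * \<phi> (if s = t then t + real i * h else s))"
    using fin k by (subst integral_measure_pmf_real[where A = "insert t (set_pmf G) \<times> {..k}"])
      (auto simp: pmf_pair mult_ac intro!: sum.cong)
  also have "\<dots> = (\<Sum>s\<in>insert t (set_pmf G). \<Sum>i\<le>k.
      pmf G s * pmf \<mu> i * \<phi> (if s = t then t + real i * h else s))"
    by (simp add: sum.cartesian_product)
  also have "\<dots> = (\<Sum>i\<le>k. pmf G t * pmf \<mu> i * \<phi> (t + real i * h))
      + (\<Sum>s\<in>set_pmf G - {t}. \<Sum>i\<le>k. pmf G s * pmf \<mu> i * \<phi> s)"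
    using fin by (subst sum.insert_remove) (auto intro!: sum.cong)
  also have "(\<Sum>s\<in>set_pmf G - {t}. \<Sum>i\<le>k. pmf G s * pmf \<mu> i * \<phi> s)
      = (\<Sum>s\<in>set_pmf G - {t}. pmf G s * \<phi> s * (\<Sum>i\<le>k. pmf \<mu> i))"
    by (simp add: sum_distrib_left mult_ac)
  finally show ?thesis by (simp add: one sum_distrib_left mult_ac)
qed

section \<open>The two parity halves of the binomial weights\<close>

text \<open>Even and odd binomial coefficients have the same sum, 2^j, when the upper index is
  positive; hence the form \<open>Suc j\<close>.\<close>

lemma ex_parity_pmf:
  "\<exists>\<mu> :: nat pmf. \<forall>i. pmf \<mu> i = (if even i = b then real (Suc j choose i) / 2 ^ j else 0)"
proof -
  let ?w = "\<lambda>i. if even i = b then real (Suc j choose i) / 2 ^ j else 0"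
  have "2 * (\<Sum>i\<le>Suc j. if even i = b then real (Suc j choose i) else 0) = 2 ^ Suc j"
    using choose_even_sum[of "Suc j", where 'a = real] choose_odd_sum[of "Suc j", where 'a = real]
    by (cases b) simp_all
  then have "(\<Sum>i\<le>Suc j. if even i = b then real (Suc j choose i) else 0) / 2 ^ j = 1"
    by simp
  also have "(\<Sum>i\<le>Suc j. if even i = b then real (Suc j choose i) else 0) / 2 ^ j = (\<Sum>i\<le>Suc j. ?w i)"
    unfolding sum_divide_distrib by (intro sum.cong) auto
  finally have one: "(\<Sum>i\<le>Suc j. ?w i) = 1" .
  have "(\<integral>\<^sup>+i. ennreal (?w i) \<partial>count_space UNIV) = (\<Sum>i\<le>Suc j. ennreal (?w i))"
    by (intro nn_integral_count_space') (auto simp: binomial_eq_0 not_le)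
  also have "\<dots> = 1" using one by (subst sum_ennreal) auto
  finally have "pmf (embed_pmf ?w) i = ?w i" for i
    by (intro pmf_embed_pmf) auto
  then show ?thesis by blast
qed

lemma card_parity: "card {i. i \<le> Suc (2 * d) \<and> even i = b} = Suc d"
proof (cases b)
  case True
  have "{i. i \<le> Suc (2 * d) \<and> even i = b} = (\<lambda>i. 2 * i) ` {..d}"
    using True by (auto elim!: evenE)
  then show ?thesis by (simp add: card_image inj_on_def)
next
  case False
  have "{i. i \<le> Suc (2 * d) \<and> even i = b} = (\<lambda>i. Suc (2 * i)) ` {..d}"
    using False by (auto elim!: oddE)
  then show ?thesis by (simp add: card_image inj_on_def)
qed

text \<open>
  The two halves, by parity, of the binomial weights of a \<open>k\<close>-th finite difference have the same
  moments up to order \<open>k - 1\<close>. Here \<open>k = 2 d + 1\<close>, so either half has \<open>d + 1\<close> atoms.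
\<close>
definition parity_pmf :: "nat \<Rightarrow> bool \<Rightarrow> nat pmf" where
  "parity_pmf d b = (SOME \<mu>. \<forall>i. pmf \<mu> i = (if even i = b then real (Suc (2 * d) choose i) / 2 ^ (2 * d) else 0))"

lemma pmf_parity_pmf:
  "pmf (parity_pmf d b) i = (if even i = b then real (Suc (2 * d) choose i) / 2 ^ (2 * d) else 0)"
proof -
  have "\<exists>\<mu> :: nat pmf. \<forall>i. pmf \<mu> i = (if even i = b then real (Suc (2 * d) choose i) / 2 ^ (2 * d) else 0)"
    by (rule ex_parity_pmf)
  from someI_ex[OF this] show ?thesis unfolding parity_pmf_def by blast
qed

lemma set_parity_pmf: "set_pmf (parity_pmf d b) = {i. i \<le> Suc (2 * d) \<and> even i = b}"
  by (auto simp: set_pmf_eq pmf_parity_pmf)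

text \<open>The class asks for exactly m atoms, so collisions must be excluded. All displacements go
  to the right, hence only atoms to the right of \<open>t\<close> matter, and \<open>gap\<close>
  keeps them out of reach. The count is (m0 - 1) + (d + 1); the index 0 belongs to the even half,
  which thus retains \<open>t\<close>.\<close>

lemma split_parity_in_mixing:
  assumes G: "G \<in> mixing \<Theta> m0" and t: "t \<in> set_pmf G" and h: "0 < h" and m: "1 \<le> m0"
    and sub: "{t..t + real (Suc (2 * d)) * h} \<subseteq> \<Theta>"
    and gap: "\<And>s. s \<in> set_pmf G \<Longrightarrow> t < s \<Longrightarrow> t + real (Suc (2 * d)) * h < s"
  shows "split_atom t h (parity_pmf d b) G \<in> mixing \<Theta> (m0 + d)"
proof -
  let ?A = "(\<lambda>i. t + real i * h) ` set_pmf (parity_pmf d b)"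
  have A: "?A \<subseteq> {t..t + real (Suc (2 * d)) * h}"
    using h by (auto simp: set_parity_pmf intro!: mult_right_mono)
  have card: "card ?A = Suc d"
    using h by (subst card_image) (auto simp: inj_on_def set_parity_pmf card_parity)
  have disj: "(set_pmf G - {t}) \<inter> ?A = {}"
  proof (rule ccontr)
    assume "(set_pmf G - {t}) \<inter> ?A \<noteq> {}"
    then obtain s where s: "s \<in> set_pmf G" "s \<noteq> t" "s \<in> {t..t + real (Suc (2 * d)) * h}" using A by blast
    then show False using gap[of s] by simp
  qed
  have fin: "finite (set_pmf G)" "finite ?A"
    using G by (auto simp: mixing_def set_parity_pmf)
  then have "card (set_pmf (split_atom t h (parity_pmf d b) G)) = card (set_pmf G - {t}) + card ?A"
    unfolding set_pmf_split_atom[OF t] using disj by (intro card_Un_disjoint) auto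
  also have "\<dots> = m0 + d" using G t m fin card by (simp add: mixing_def)
  finally show ?thesis
    using G fin A sub unfolding mixing_def by (auto simp: set_pmf_split_atom[OF t])
qed

lemma integral_split_parity:
  fixes \<phi> :: "real \<Rightarrow> real"
  assumes "finite (set_pmf G)"
  shows "(\<integral>s. \<phi> s \<partial>split_atom t h (parity_pmf d b) G) = (\<Sum>s\<in>set_pmf G - {t}. pmf G s * \<phi> s)
    + pmf G t / 2 ^ (2 * d) *
      (\<Sum>i\<le>Suc (2 * d). if even i = b then real (Suc (2 * d) choose i) * \<phi> (t + real i * h) else 0)"
  by (subst integral_split_atom[OF assms, where k = "Suc (2 * d)"])
     (auto simp: set_parity_pmf pmf_parity_pmf sum_distrib_left simp del: sum.atMost_Suc intro!: sum.cong)

text \<open>The untouched atoms cancel, and the parity supplies the sign. Taking densities for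
  \<open>\<phi>\<close> gives a finite difference; taking indicators of half-lines gives the
  difference of the distribution functions.\<close>

lemma integral_split_parity_diff:
  fixes \<phi> :: "real \<Rightarrow> real"
  assumes "finite (set_pmf G)"
  shows "(\<integral>s. \<phi> s \<partial>split_atom t h (parity_pmf d True) G) - (\<integral>s. \<phi> s \<partial>split_atom t h (parity_pmf d False) G)
    = pmf G t / 2 ^ (2 * d) *
      (\<Sum>i\<le>Suc (2 * d). (- 1) ^ i * real (Suc (2 * d) choose i) * \<phi> (t + real i * h))"
proof -
  have "(\<Sum>i\<le>Suc (2 * d). (- 1) ^ i * real (Suc (2 * d) choose i) * \<phi> (t + real i * h))
     = (\<Sum>i\<le>Suc (2 * d). if even i = True then real (Suc (2 * d) choose i) * \<phi> (t + real i * h) else 0)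
       - (\<Sum>i\<le>Suc (2 * d). if even i = False then real (Suc (2 * d) choose i) * \<phi> (t + real i * h) else 0)"
    unfolding sum_subtractf[symmetric] by (intro sum.cong) auto
  then show ?thesis
    unfolding integral_split_parity[OF assms] by (simp only: right_diff_distrib)
qed

text \<open>Every index has one of the two parities and a binomial coefficient of at least 1. The
  sum of the two mixture densities thus dominates a fixed multiple of each displaced
  component.\<close>

lemma integral_split_parity_sum_ge:
  fixes \<phi> :: "real \<Rightarrow> real"
  assumes "finite (set_pmf G)" and nn: "\<And>s. s \<in> set_pmf G \<Longrightarrow> 0 \<le> \<phi> s"
    "\<And>i. i \<le> Suc (2 * d) \<Longrightarrow> 0 \<le> \<phi> (t + real i * h)" and i: "i \<le> Suc (2 * d)"
  shows "pmf G t / 2 ^ (2 * d) * \<phi> (t + real i * h)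
    \<le> (\<integral>s. \<phi> s \<partial>split_atom t h (parity_pmf d True) G) + (\<integral>s. \<phi> s \<partial>split_atom t h (parity_pmf d False) G)"
proof -
  let ?c = "pmf G t / 2 ^ (2 * d)" and ?w = "\<lambda>i. real (Suc (2 * d) choose i) * \<phi> (t + real i * h)"
  have "?c * \<phi> (t + real i * h) \<le> ?c * ?w i"
    using nn(2)[OF i] i by (intro mult_left_mono) (auto simp: mult_le_cancel_right1 Suc_le_eq simp del: binomial_Suc_Suc)
  also have "\<dots> \<le> ?c * (\<Sum>i\<le>Suc (2 * d). ?w i)"
    using nn(2) i by (intro mult_left_mono member_le_sum) auto
  also have "(\<Sum>i\<le>Suc (2 * d). ?w i)
      = (\<Sum>i\<le>Suc (2 * d). if even i = True then ?w i else 0) + (\<Sum>i\<le>Suc (2 * d). if even i = False then ?w i else 0)"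
    unfolding sum.distrib[symmetric] by (intro sum.cong) auto
  also have "?c * \<dots> \<le> (\<Sum>s\<in>set_pmf G - {t}. pmf G s * \<phi> s) + (\<Sum>s\<in>set_pmf G - {t}. pmf G s * \<phi> s) + ?c * \<dots>"
    using nn(1) by (simp only: le_add_same_cancel2) (auto intro!: add_nonneg_nonneg sum_nonneg)
  finally show ?thesis unfolding integral_split_parity[OF assms(1)] by (simp only: distrib_left add_ac)
qed

lemma bounded_set_split_parity:
  assumes "finite (set_pmf G)"
  shows "bounded (set_pmf (split_atom t h (parity_pmf d b) G))"
  using assms by (intro finite_imp_bounded) (simp add: split_atom_def set_parity_pmf)

section \<open>Wasserstein distances of the split mixtures\<close>

lemma prob_eq_integral_indicator: "measure_pmf.prob P A = (\<integral>s. indicator A s \<partial>measure_pmf P)"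
  by simp

text \<open>For \<open>u\<close> in the interval from \<open>t\<close> to \<open>t + h\<close>,
  right end excluded, index 0 alone lies at or below \<open>u\<close>. The distribution functions
  therefore differ by the constant weight of that term over a length \<open>h\<close>.\<close>

lemma W_split_parity_ge:
  assumes fin: "finite (set_pmf G)" and h: "0 < h"
  shows "pmf G t / 2 ^ (2 * d) * h
    \<le> W (split_atom t h (parity_pmf d True) G) (split_atom t h (parity_pmf d False) G)"
proof -
  let ?P = "\<lambda>b. split_atom t h (parity_pmf d b) G" and ?c = "pmf G t / 2 ^ (2 * d)"
  have diff: "measure_pmf.prob (?P True) {..u} - measure_pmf.prob (?P False) {..u} = ?c" if u: "u \<in> {t..<t + h}" for u
  proof -
    have "indicator {..u} (t + real i * h) = (if i = 0 then 1 else 0 :: real)" for i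
    proof (cases i)
      case (Suc l)
      then have "t + h \<le> t + real i * h" "i \<noteq> 0" using h by (auto simp: distrib_right)
      moreover from this(1) have "\<not> t + real i * h \<le> u" using u unfolding atLeastLessThan_iff by linarith
      ultimately show ?thesis by (simp add: indicator_def)
    qed (use u in simp)
    then have "(\<Sum>i\<le>Suc (2 * d). (- 1) ^ i * real (Suc (2 * d) choose i) * indicator {..u} (t + real i * h))
        = (\<Sum>i\<le>Suc (2 * d). if i = 0 then 1 else 0 :: real)"
      by (intro sum.cong) auto
    also have "\<dots> = 1" by (subst sum.delta) auto
    finally show ?thesis
      unfolding prob_eq_integral_indicator integral_split_parity_diff[OF fin] by (simp del: sum.atMost_Suc)
  qed
  have "?c * h = (\<integral>u. ?c * indicator {t..<t + h} u \<partial>lborel)"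
    using h by simp
  also have "\<dots> \<le> W (?P True) (?P False)"
    unfolding W_def
  proof (intro integral_mono)
    show "integrable lborel (\<lambda>u. \<bar>measure_pmf.prob (?P True) {..u} - measure_pmf.prob (?P False) {..u}\<bar>)"
      by (intro integrable_abs integrable_cdf_diff bounded_set_split_parity fin)
    show "?c * indicator {t..<t + h} u \<le> \<bar>measure_pmf.prob (?P True) {..u} - measure_pmf.prob (?P False) {..u}\<bar>" for u
      using diff[of u] by (auto simp: indicator_def)
    show "integrable lborel (\<lambda>u. ?c * indicator {t..<t + h} u)"
      by (intro integrable_mult_right integrable_real_indicator) (use h in auto)
  qed
  finally show ?thesis .
qed

text \<open>Mass moves only within an interval of length (2 d + 1) h. Outside it the half-line up to
  \<open>u\<close> contains either \<open>t\<close> and all displaced points or none of them; inside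
  it the difference is at most 1.\<close>

lemma W_split_parity_le:
  assumes fin: "finite (set_pmf G)" and h: "0 < h" and t: "t \<in> set_pmf G"
  shows "W (split_atom t h (parity_pmf d b) G) G \<le> real (Suc (2 * d)) * h"
proof -
  let ?P = "split_atom t h (parity_pmf d b) G" and ?I = "{t..t + real (Suc (2 * d)) * h}"
  have int_diff: "(\<integral>s. \<phi> s \<partial>?P) - (\<integral>s. \<phi> s \<partial>measure_pmf G)
      = pmf G t * (\<Sum>i\<le>Suc (2 * d). pmf (parity_pmf d b) i * (\<phi> (t + real i * h) - \<phi> t))" for \<phi> :: "real \<Rightarrow> real"
  proof -
    have "(\<integral>s. \<phi> s \<partial>measure_pmf G) = (\<Sum>s\<in>set_pmf G. pmf G s * \<phi> s)"
      using fin by (subst integral_measure_pmf_real[where A = "set_pmf G"]) (auto simp: mult.commute)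
    also have "\<dots> = pmf G t * \<phi> t + (\<Sum>s\<in>set_pmf G - {t}. pmf G s * \<phi> s)"
      using fin t by (simp add: sum.remove)
    also have "\<phi> t = (\<Sum>i\<le>Suc (2 * d). pmf (parity_pmf d b) i) * \<phi> t"
      by (subst sum_pmf_eq_1) (auto simp: set_parity_pmf)
    finally show ?thesis
      by (subst integral_split_atom[OF fin, where k = "Suc (2 * d)"])
         (auto simp: set_parity_pmf sum_subtractf right_diff_distrib sum_distrib_right simp del: sum.atMost_Suc)
  qed
  have "\<bar>measure_pmf.prob ?P {..u} - measure_pmf.prob G {..u}\<bar> \<le> indicator ?I u" for u
  proof (cases "u \<in> ?I")
    case True
    then show ?thesis
      using measure_pmf.prob_le_1[of ?P "{..u}"] measure_pmf.prob_le_1[of G "{..u}"]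
        measure_nonneg[of ?P "{..u}"] measure_nonneg[of G "{..u}"]
      by (simp only: indicator_simps abs_le_iff) linarith
  next
    case False
    have "indicator {..u} (t + real i * h) = (indicator {..u} t :: real)" if "i \<le> Suc (2 * d)" for i
    proof -
      have "0 \<le> real i * h" "real i * h \<le> real (Suc (2 * d)) * h"
        using that h by (auto intro!: mult_right_mono simp del: of_nat_Suc)
      then show ?thesis using False by (auto simp: indicator_def simp del: of_nat_Suc)
    qed
    then show ?thesis
      unfolding prob_eq_integral_indicator int_diff by (simp del: sum.atMost_Suc)
  qed
  then have "W ?P G \<le> (\<integral>u. indicator ?I u \<partial>lborel)"
    unfolding W_def using fin
    by (intro integral_mono integrable_abs integrable_cdf_diff bounded_set_split_parity finite_imp_bounded
        integrable_real_indicator) (auto simp: emeasure_lborel_Icc_eq)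
  also have "\<dots> = real (Suc (2 * d)) * h" using h by simp
  finally show ?thesis .
qed

section \<open>The distance between the two mixture densities\<close>

text \<open>With first and third parameter equal, one factor of the squared denominator cancels
  against the density. Where \<open>f x a = 0\<close> the left integrand is 0, because
  \<open>inverse 0 = 0\<close> on the reals.\<close>

lemma nn_integral_power2_div_le_E_pq:
  assumes [measurable]: "(\<lambda>x. f x a) \<in> borel_measurable M" "(\<lambda>x. D p x s) \<in> borel_measurable M"
    and nn: "\<And>x. x \<in> space M \<Longrightarrow> 0 \<le> f x a"
  shows "(\<integral>\<^sup>+x. ennreal ((D p x s)\<^sup>2) * ennreal (inverse (f x a)) \<partial>M) \<le> E_pq M f D p 2 a s a"
proof -
  have [measurable]: "(\<lambda>y. ennpowr y 2) \<in> borel_measurable borel"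
    unfolding ennpowr_def by measurable
  have "E_pq M f D p 2 a s a
      = (\<integral>\<^sup>+x. ennreal (f x a) * ennpowr (ennreal \<bar>D p x s\<bar> / ennreal (f x a)) 2 \<partial>M)"
    unfolding E_pq_def by (rule nn_integral_density) measurable
  moreover have "ennreal ((D p x s)\<^sup>2) * ennreal (inverse (f x a))
      \<le> ennreal (f x a) * ennpowr (ennreal \<bar>D p x s\<bar> / ennreal (f x a)) 2" if "x \<in> space M" for x
  proof (cases "f x a = 0")
    case False
    then have pos: "0 < f x a" using nn[OF that] by simp
    have "ennpowr (ennreal \<bar>D p x s\<bar> / ennreal (f x a)) 2 = ennreal ((\<bar>D p x s\<bar> / f x a) powr 2)"
      using pos by (simp add: divide_ennreal ennpowr_def)
    also have "(\<bar>D p x s\<bar> / f x a) powr 2 = (D p x s)\<^sup>2 / (f x a)\<^sup>2"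
      using pos by (simp add: power_divide)
    finally show ?thesis
      using pos by (simp add: ennreal_mult'[symmetric] ennreal_mult''[symmetric] power2_eq_square field_simps)
  qed simp
  ultimately show ?thesis by (simp add: nn_integral_mono)
qed

text \<open>The pointwise integral bound is squared by Cauchy-Schwarz and integrated over
  \<open>x\<close> first. The order of the difference is k + 1: h^(2 k) comes from the first k
  steps, one interval length from Cauchy-Schwarz and one from integrating \<open>K\<close> over the
  parameter.\<close>

lemma nn_integral_finite_difference_le:
  fixes g :: "nat \<Rightarrow> 'a \<Rightarrow> real \<Rightarrow> real" and w :: "'a \<Rightarrow> ennreal"
  assumes sf: "sigma_finite_measure M" and h: "0 \<le> h"
    and der: "\<And>x j s. x \<in> space M \<Longrightarrow> j \<le> k \<Longrightarrow> s \<in> {y..y + real (Suc k) * h} \<Longrightarrow>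
      (g j x has_real_derivative g (Suc j) x s) (at s within {y..y + real (Suc k) * h})"
    and cont: "\<And>x. x \<in> space M \<Longrightarrow> continuous_on {y..y + real (Suc k) * h} (g (Suc k) x)"
    and meas: "\<And>s. s \<in> {y..y + real (Suc k) * h} \<Longrightarrow> (\<lambda>x. g (Suc k) x s) \<in> borel_measurable M"
    and [measurable]: "w \<in> borel_measurable M"
    and K: "\<And>s. s \<in> {y..y + real (Suc k) * h} \<Longrightarrow> (\<integral>\<^sup>+x. ennreal ((g (Suc k) x s)\<^sup>2) * w x \<partial>M) \<le> K"
  shows "(\<integral>\<^sup>+x. ennreal ((\<Sum>i\<le>Suc k. (- 1) ^ i * real (Suc k choose i) * g 0 x (y + real i * h))\<^sup>2) * w x \<partial>M)
    \<le> ennreal (h ^ (2 * k) * (real (Suc k) * h)) * (K * ennreal (real (Suc k) * h))"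
proof -
  define r where "r = real (Suc k) * h"
  have r: "0 \<le> r" using h by (simp add: r_def)
  interpret sigma_finite_measure M by fact
  interpret pair_sigma_finite M "lborel :: real measure" ..
  \<comment> \<open>The derivative is regular only on the interval. Clamping the parameter extends
    it to a continuous function on the whole line, as joint measurability requires.\<close>
  define G where "G x s = g (Suc k) x (max y (min s (y + r)))" for x s
  have clamp: "max y (min s (y + r)) \<in> {y..y + r}" for s using r by auto
  have Geq: "G x s = g (Suc k) x s" if "s \<in> {y..y + r}" for x s
    using that by (simp add: G_def)
  have [measurable]: "(\<lambda>(x, s). G x s) \<in> borel_measurable (M \<Otimes>\<^sub>M lborel)"
  proof (rule borel_measurable_right_continuous_pair)
    show "(\<lambda>x. G x s) \<in> borel_measurable M" for s
      unfolding G_def using meas clamp unfolding r_def by blast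
    fix x s assume x: "x \<in> space M"
    have "continuous_on UNIV (\<lambda>s. g (Suc k) x (max y (min s (y + r))))"
      by (rule continuous_on_compose2[OF cont[OF x]]) (use clamp in \<open>auto simp: r_def intro!: continuous_intros\<close>)
    then show "continuous (at_right s) (G x)"
      unfolding G_def by (simp add: continuous_on_eq_continuous_within continuous_at_imp_continuous_within)
  qed
  have pt: "ennreal ((\<Sum>i\<le>Suc k. (- 1) ^ i * real (Suc k choose i) * g 0 x (y + real i * h))\<^sup>2)
      \<le> ennreal (h ^ (2 * k) * r) * (\<integral>\<^sup>+s. ennreal ((G x s)\<^sup>2) * indicator {y..y + r} s \<partial>lborel)"
    if x: "x \<in> space M" for x
  proof -
    let ?S = "\<Sum>i\<le>Suc k. (- 1) ^ i * real (Suc k choose i) * g 0 x (y + real i * h)"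
    let ?J = "integral {y..y + r} (\<lambda>s. \<bar>g (Suc k) x s\<bar>)"
    have "\<bar>?S\<bar> \<le> h ^ k * ?J"
      unfolding r_def using h der[OF x] cont[OF x]
      by (intro finite_difference_le_integral[of h k y "\<lambda>j. g j x"]) auto
    then have "?S\<^sup>2 \<le> (h ^ k * ?J)\<^sup>2" by (rule abs_le_square_iff[THEN iffD1, OF order.trans[OF _ abs_ge_self]])
    also have "\<dots> = h ^ (2 * k) * ?J\<^sup>2" by (simp add: power_mult_distrib power_mult[symmetric] mult.commute)
    finally have "ennreal (?S\<^sup>2) \<le> ennreal (h ^ (2 * k)) * ennreal (?J\<^sup>2)"
      using h by (simp only: ennreal_mult[symmetric] zero_le_power zero_le_power2 ennreal_leI)
    also have "\<dots> \<le> ennreal (h ^ (2 * k)) * (ennreal (y + r - y) * (\<integral>\<^sup>+s. ennreal ((g (Suc k) x s)\<^sup>2) * indicator {y..y + r} s \<partial>lborel))"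
      using r cont[OF x] by (intro mult_left_mono power2_integral_abs_le) (auto simp: r_def)
    also have "(\<integral>\<^sup>+s. ennreal ((g (Suc k) x s)\<^sup>2) * indicator {y..y + r} s \<partial>lborel)
        = (\<integral>\<^sup>+s. ennreal ((G x s)\<^sup>2) * indicator {y..y + r} s \<partial>lborel)"
      by (intro nn_integral_cong) (auto simp: indicator_def Geq)
    finally show ?thesis using h r by (simp add: ennreal_mult mult.assoc)
  qed
  have "(\<integral>\<^sup>+x. ennreal ((\<Sum>i\<le>Suc k. (- 1) ^ i * real (Suc k choose i) * g 0 x (y + real i * h))\<^sup>2) * w x \<partial>M)
      \<le> (\<integral>\<^sup>+x. ennreal (h ^ (2 * k) * r) * (\<integral>\<^sup>+s. ennreal ((G x s)\<^sup>2) * indicator {y..y + r} s \<partial>lborel) * w x \<partial>M)"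
    by (intro nn_integral_mono mult_right_mono pt) auto
  also have "\<dots> = (\<integral>\<^sup>+x. ennreal (h ^ (2 * k) * r) * (\<integral>\<^sup>+s. ennreal ((G x s)\<^sup>2) * w x * indicator {y..y + r} s \<partial>lborel) \<partial>M)"
  proof (intro nn_integral_cong)
    fix x assume [simp]: "x \<in> space M"
    have [measurable]: "(\<lambda>s. G x s) \<in> borel_measurable lborel"
      using measurable_Pair2[of "\<lambda>(x, s). G x s" M lborel borel x] by simp
    show "ennreal (h ^ (2 * k) * r) * (\<integral>\<^sup>+s. ennreal ((G x s)\<^sup>2) * indicator {y..y + r} s \<partial>lborel) * w x
        = ennreal (h ^ (2 * k) * r) * (\<integral>\<^sup>+s. ennreal ((G x s)\<^sup>2) * w x * indicator {y..y + r} s \<partial>lborel)"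
      by (simp add: nn_integral_cmult mult_ac)
  qed
  also have "\<dots> = ennreal (h ^ (2 * k) * r) * (\<integral>\<^sup>+x. (\<integral>\<^sup>+s. ennreal ((G x s)\<^sup>2) * w x * indicator {y..y + r} s \<partial>lborel) \<partial>M)"
    by (intro nn_integral_cmult) measurable
  also have "(\<integral>\<^sup>+x. (\<integral>\<^sup>+s. ennreal ((G x s)\<^sup>2) * w x * indicator {y..y + r} s \<partial>lborel) \<partial>M)
      = (\<integral>\<^sup>+s. (\<integral>\<^sup>+x. ennreal ((G x s)\<^sup>2) * w x * indicator {y..y + r} s \<partial>M) \<partial>lborel)"
    by (intro Fubini'[symmetric]) measurable
  also have "\<dots> \<le> (\<integral>\<^sup>+s. K * indicator {y..y + r} s \<partial>lborel)"
    using K by (intro nn_integral_mono) (auto simp: indicator_def Geq r_def)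
  also have "\<dots> = K * ennreal r"
    using r by (simp add: nn_integral_cmult)
  finally show ?thesis
    unfolding r_def by (simp add: mult_left_mono)
qed

section \<open>Mixture densities and their symmetric chi-square distance\<close>

lemma mix_density_eq_sum:
  assumes "finite (set_pmf G)"
  shows "mix_density f x G = (\<Sum>s\<in>set_pmf G. f x s * pmf G s)"
  unfolding mix_density_def using assms by (intro integral_measure_pmf_real) auto

lemma mix_density_is_density:
  assumes dens: "density_family \<Theta> M f" and fin: "finite (set_pmf G)" and sub: "set_pmf G \<subseteq> \<Theta>"
  shows "(\<lambda>x. mix_density f x G) \<in> borel_measurable M"
    and "\<And>x. x \<in> space M \<Longrightarrow> 0 \<le> mix_density f x G"
    and "(\<integral>\<^sup>+x. ennreal (mix_density f x G) \<partial>M) = 1"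
proof -
  have meas: "(\<lambda>x. f x s) \<in> borel_measurable M" and int: "(\<integral>\<^sup>+x. ennreal (f x s) \<partial>M) = 1"
    and nn: "x \<in> space M \<Longrightarrow> 0 \<le> f x s" if "s \<in> set_pmf G" for s x
    using dens sub that unfolding density_family_def by auto
  show "(\<lambda>x. mix_density f x G) \<in> borel_measurable M"
    unfolding mix_density_eq_sum[OF fin] using meas by (intro borel_measurable_sum borel_measurable_times) auto
  show "0 \<le> mix_density f x G" if "x \<in> space M" for x
    unfolding mix_density_eq_sum[OF fin] using nn that by (intro sum_nonneg mult_nonneg_nonneg) auto
  have "(\<integral>\<^sup>+x. ennreal (mix_density f x G) \<partial>M)
      = (\<integral>\<^sup>+x. (\<Sum>s\<in>set_pmf G. ennreal (f x s) * ennreal (pmf G s)) \<partial>M)"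
    unfolding mix_density_eq_sum[OF fin] using nn
    by (intro nn_integral_cong) (simp add: ennreal_mult[symmetric] sum_nonneg)
  also have "\<dots> = (\<Sum>s\<in>set_pmf G. (\<integral>\<^sup>+x. ennreal (f x s) \<partial>M) * ennreal (pmf G s))"
    using meas by (subst nn_integral_sum) (auto simp: nn_integral_multc)
  also have "\<dots> = ennreal (\<Sum>s\<in>set_pmf G. pmf G s)"
    using int by simp
  also have "\<dots> = 1" using fin by (simp add: sum_pmf_eq_1)
  finally show "(\<integral>\<^sup>+x. ennreal (mix_density f x G) \<partial>M) = 1" .
qed

text \<open>Pointwise the numerator is (c S)^2 with S the finite difference, and the denominator is
  at least c \<open>f x (t + i h)\<close> for each i. Which i gives a positive bound depends on x,
  so all k + 1 quotients are summed. Each has integral at most K (k h)^2 h^(2 (k - 1)).\<close>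

lemma nn_integral_split_parity_le:
  fixes \<Theta> :: "real set" and M :: "'a measure" and d :: nat and G :: "real pmf" and t h K :: real
    and f :: "'a \<Rightarrow> real \<Rightarrow> real" and D :: "nat \<Rightarrow> 'a \<Rightarrow> real \<Rightarrow> real"
  defines "k \<equiv> Suc (2 * d)"
  defines "I \<equiv> {t..t + real k * h}"
  defines "p \<equiv> \<lambda>b x. mix_density f x (split_atom t h (parity_pmf d b) G)"
  assumes sf: "sigma_finite_measure M" and dens: "density_family \<Theta> M f"
    and der: "theta_derivs \<Theta> M f D (Suc k)"
    and meas: "\<And>s. s \<in> \<Theta> \<Longrightarrow> (\<lambda>x. D k x s) \<in> borel_measurable M"
    and fin: "finite (set_pmf G)" and sub: "set_pmf G \<subseteq> \<Theta>" "I \<subseteq> \<Theta>" and h: "0 < h"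
    and K: "\<And>a s. a \<in> I \<Longrightarrow> s \<in> I \<Longrightarrow> E_pq M f D k 2 a s a \<le> ennreal K" "0 \<le> K"
  shows "(\<integral>\<^sup>+x. ennreal ((p True x - p False x)\<^sup>2 / (p True x + p False x)) \<partial>M)
    \<le> ennreal (real (Suc k) * (real k)\<^sup>2 * K * h ^ (2 * k))"
proof -
  define S where "S x = (\<Sum>i\<le>k. (- 1) ^ i * real (k choose i) * f x (t + real i * h))" for x
  define c where "c = pmf G t / 2 ^ (2 * d)"
  have c: "0 \<le> c" "c \<le> 1"
    using pmf_le_1[of G t] by (auto simp: c_def divide_le_eq intro: order.trans[OF _ one_le_power])
  have pts: "t + real i * h \<in> I" if "i \<le> k" for i
    using that h by (auto simp: I_def intro!: mult_right_mono)
  have fnn: "0 \<le> f x s" if "x \<in> space M" "s \<in> \<Theta>" for x s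
    using dens that by (auto simp: density_family_def)
  have fmeas: "(\<lambda>x. f x s) \<in> borel_measurable M" if "s \<in> \<Theta>" for s
    using dens that by (auto simp: density_family_def)
  have dI: "(D j x has_real_derivative D (Suc j) x s) (at s within I)" if "x \<in> space M" "s \<in> I" "j \<le> k" for j x s
    using der that sub(2) by (intro DERIV_subset[OF _ sub(2)]) (auto simp: theta_derivs_def less_Suc_eq_le)
  have D0: "D 0 x s = f x s" if "x \<in> space M" "s \<in> I" for x s
    using der that sub(2) by (auto simp: theta_derivs_def)
  have pt: "(p True x - p False x)\<^sup>2 / (p True x + p False x) \<le> (\<Sum>i\<le>k. (S x)\<^sup>2 * inverse (f x (t + real i * h)))"
    if x: "x \<in> space M" for x
  proof -
    have fi: "0 \<le> f x (t + real i * h)" if "i \<le> k" for i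
      using fnn[OF x] pts[OF that] sub(2) by blast
    have diff: "p True x - p False x = c * S x"
      unfolding p_def mix_density_def c_def S_def k_def by (rule integral_split_parity_diff[OF fin])
    have ge: "c * f x (t + real i * h) \<le> p True x + p False x" if "i \<le> k" for i
      unfolding p_def mix_density_def c_def
      using that fi fnn[OF x] sub(1) by (intro integral_split_parity_sum_ge fin) (auto simp: k_def)
    have nonneg: "0 \<le> (S x)\<^sup>2 * inverse (f x (t + real i * h))" if "i \<le> k" for i
      using fi[OF that] by simp
    show ?thesis
    proof (cases "c * S x = 0")
      case True
      have "0 \<le> (\<Sum>i\<le>k. (S x)\<^sup>2 * inverse (f x (t + real i * h)))"
        by (intro sum_nonneg nonneg) simp
      then show ?thesis unfolding diff True by simp
    next
      case False
      then have cS: "0 < c" "S x \<noteq> 0" using c by auto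
      \<comment> \<open>If all the displaced densities vanished at \<open>x\<close>, so would their
        finite difference.\<close>
      then obtain i where i: "i \<le> k" "f x (t + real i * h) \<noteq> 0"
        unfolding S_def by (metis (mono_tags, lifting) atMost_iff mult_zero_right sum.neutral)
      then have pos: "0 < f x (t + real i * h)" using fi[of i] by simp
      have "(c * S x)\<^sup>2 / (p True x + p False x) \<le> (c * S x)\<^sup>2 / (c * f x (t + real i * h))"
        using ge[OF i(1)] cS pos by (intro divide_left_mono mult_pos_pos order.strict_trans2[OF _ ge[OF i(1)]]) auto
      also have "\<dots> = c * ((S x)\<^sup>2 * inverse (f x (t + real i * h)))"
        using cS by (simp add: power2_eq_square field_simps)
      also have "\<dots> \<le> 1 * ((S x)\<^sup>2 * inverse (f x (t + real i * h)))"
        using c nonneg[OF i(1)] by (intro mult_right_mono)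
      also have "\<dots> \<le> (\<Sum>i\<le>k. (S x)\<^sup>2 * inverse (f x (t + real i * h)))"
        using i(1) nonneg by (simp only: mult_1_left) (intro member_le_sum, auto)
      finally show ?thesis unfolding diff .
    qed
  qed
  have Smeas: "S \<in> borel_measurable M"
    unfolding S_def using fmeas pts sub(2) by (intro borel_measurable_sum borel_measurable_times) auto
  have wmeas: "(\<lambda>x. ennreal (inverse (f x (t + real i * h)))) \<in> borel_measurable M" if "i \<le> k" for i
    using fmeas pts[OF that] sub(2) by (intro measurable_compose[OF borel_measurable_inverse measurable_ennreal]) auto
  have term_le: "(\<integral>\<^sup>+x. ennreal ((S x)\<^sup>2) * ennreal (inverse (f x (t + real i * h))) \<partial>M)
      \<le> ennreal (h ^ (2 * (2 * d)) * (real k * h)) * (ennreal K * ennreal (real k * h))" if i: "i \<le> k" for i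
  proof -
    have "(\<integral>\<^sup>+x. ennreal ((S x)\<^sup>2) * ennreal (inverse (f x (t + real i * h))) \<partial>M)
        = (\<integral>\<^sup>+x. ennreal ((\<Sum>j\<le>k. (- 1) ^ j * real (k choose j) * D 0 x (t + real j * h))\<^sup>2)
            * ennreal (inverse (f x (t + real i * h))) \<partial>M)"
      unfolding S_def using D0 pts by (intro nn_integral_cong) simp
    also have "\<dots> \<le> ennreal (h ^ (2 * (2 * d)) * (real k * h)) * (ennreal K * ennreal (real k * h))"
      unfolding k_def
    proof (rule nn_integral_finite_difference_le[OF sf], unfold k_def[symmetric] I_def[symmetric])
      show "0 \<le> h" using h by simp
      show "(D j x has_real_derivative D (Suc j) x s) (at s within I)"
        if "x \<in> space M" "j \<le> 2 * d" "s \<in> I" for x j s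
        using dI[of x s j] that by (simp add: k_def)
      \<comment> \<open>This is what the derivative of order \<open>Suc k\<close> is for.\<close>
      show "continuous_on I (D k x)" if "x \<in> space M" for x
        using dI[OF that _ order_refl] by (intro DERIV_continuous_on)
      show "(\<lambda>x. D k x s) \<in> borel_measurable M" if "s \<in> I" for s
        using meas that sub(2) by blast
      show "(\<lambda>x. ennreal (inverse (f x (t + real i * h)))) \<in> borel_measurable M"
        by (rule wmeas[OF i])
      fix s assume s: "s \<in> I"
      have "(\<integral>\<^sup>+x. ennreal ((D k x s)\<^sup>2) * ennreal (inverse (f x (t + real i * h))) \<partial>M)
          \<le> E_pq M f D k 2 (t + real i * h) s (t + real i * h)"
        using s pts[OF i] sub(2) fmeas meas fnn by (intro nn_integral_power2_div_le_E_pq) auto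
      also have "\<dots> \<le> ennreal K" using K(1) pts[OF i] s by blast
      finally show "(\<integral>\<^sup>+x. ennreal ((D k x s)\<^sup>2) * ennreal (inverse (f x (t + real i * h))) \<partial>M) \<le> ennreal K" .
    qed
    finally show ?thesis .
  qed
  have "(\<integral>\<^sup>+x. ennreal ((p True x - p False x)\<^sup>2 / (p True x + p False x)) \<partial>M)
      \<le> (\<integral>\<^sup>+x. (\<Sum>i\<le>k. ennreal ((S x)\<^sup>2) * ennreal (inverse (f x (t + real i * h)))) \<partial>M)"
  proof (intro nn_integral_mono)
    fix x assume x: "x \<in> space M"
    have "0 \<le> f x (t + real i * h)" if "i \<le> k" for i
      using fnn[OF x] pts[OF that] sub(2) by blast
    then have "(\<Sum>i\<le>k. ennreal ((S x)\<^sup>2) * ennreal (inverse (f x (t + real i * h))))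
        = ennreal (\<Sum>i\<le>k. (S x)\<^sup>2 * inverse (f x (t + real i * h)))"
      by (subst sum_ennreal[symmetric]) (auto simp: ennreal_mult)
    then show "ennreal ((p True x - p False x)\<^sup>2 / (p True x + p False x))
        \<le> (\<Sum>i\<le>k. ennreal ((S x)\<^sup>2) * ennreal (inverse (f x (t + real i * h))))"
      using pt[OF x] by (simp add: ennreal_leI)
  qed
  also have "\<dots> = (\<Sum>i\<le>k. \<integral>\<^sup>+x. ennreal ((S x)\<^sup>2) * ennreal (inverse (f x (t + real i * h))) \<partial>M)"
    using Smeas wmeas by (intro nn_integral_sum) simp
  also have "\<dots> \<le> (\<Sum>i\<le>k. ennreal (h ^ (2 * (2 * d)) * (real k * h)) * (ennreal K * ennreal (real k * h)))"
    by (intro sum_mono term_le) simp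
  also have "\<dots> = ennreal (real (Suc k)) * ennreal (h ^ (2 * (2 * d)) * (real k * h) * (K * (real k * h)))"
    using h K(2) by (simp only: sum_constant card_atMost ennreal_of_nat_eq_real_of_nat ennreal_mult mult_nonneg_nonneg
        of_nat_0_le_iff zero_le_power less_imp_le)
  also have "\<dots> = ennreal (real (Suc k) * (h ^ (2 * (2 * d)) * (real k * h) * (K * (real k * h))))"
    by (rule ennreal_mult'[symmetric]) simp
  also have "real (Suc k) * (h ^ (2 * (2 * d)) * (real k * h) * (K * (real k * h))) = real (Suc k) * (real k)\<^sup>2 * K * h ^ (2 * k)"
  proof -
    have "h ^ (2 * k) = h ^ (2 * (2 * d)) * h\<^sup>2" by (simp add: k_def power_add[symmetric])
    then show ?thesis by (simp only: power2_eq_square mult_ac)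
  qed
  finally show ?thesis .
qed

text \<open>Finiteness at (t, t, t) is an instance of the second smoothness clause, as |t - t| = 0.
  Continuity of an \<open>ennreal\<close>-valued function spreads a finite bound to a
  neighbourhood.\<close>

lemma E_pq_bounded_near_diagonal:
  assumes sm: "pq_smooth \<Theta> M f D p q" and t: "t \<in> interior \<Theta>"
  obtains r K where "0 < r" "{t..t + r} \<subseteq> \<Theta>" "0 \<le> K"
    "\<And>a s. a \<in> {t..t + r} \<Longrightarrow> s \<in> {t..t + r} \<Longrightarrow> E_pq M f D p q a s a \<le> ennreal K"
proof -
  let ?E = "\<lambda>(a, b, c). E_pq M f D p q a b c"
  have t\<Theta>: "t \<in> \<Theta>" using t interior_subset by blast
  have cont: "continuous_on (\<Theta> \<times> \<Theta> \<times> \<Theta>) ?E" and fin: "E_pq M f D p q t t t < \<infinity>"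
    using sm t\<Theta> unfolding pq_smooth_def by auto
  define K where "K = enn2real (E_pq M f D p q t t t) + 1"
  have K: "E_pq M f D p q t t t < ennreal K"
  proof -
    have "E_pq M f D p q t t t = ennreal (enn2real (E_pq M f D p q t t t))"
      using fin by simp
    also have "\<dots> < ennreal K" unfolding K_def by (intro ennreal_lessI) (auto simp: add_nonneg_pos)
    finally show ?thesis .
  qed
  have "(?E \<longlongrightarrow> ?E (t, t, t)) (at (t, t, t) within \<Theta> \<times> \<Theta> \<times> \<Theta>)"
    using cont t\<Theta> unfolding continuous_on_def by (metis SigmaI)
  then have "\<forall>\<^sub>F z in at (t, t, t) within \<Theta> \<times> \<Theta> \<times> \<Theta>. ?E z < ennreal K"
    using K by (intro order_tendstoD(2)) simp_all
  then obtain e where e: "0 < e" and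
    eE: "\<And>z. z \<in> \<Theta> \<times> \<Theta> \<times> \<Theta> \<Longrightarrow> z \<noteq> (t, t, t) \<Longrightarrow> dist z (t, t, t) < e \<Longrightarrow> ?E z < ennreal K"
    unfolding eventually_at by metis
  obtain e' where e': "0 < e'" "cball t e' \<subseteq> \<Theta>"
    using t unfolding mem_interior_cball by blast
  \<comment> \<open>The distance in the product is at most the sum of three coordinate distances,
    and 3 e / 4 < e.\<close>
  define r where "r = min e' (e / 4)"
  have r: "0 < r" "r \<le> e'" "r \<le> e / 4" using e e' by (auto simp: r_def)
  have sub: "{t..t + r} \<subseteq> \<Theta>" using e'(2) r by (auto simp: dist_real_def subset_iff)
  have "E_pq M f D p q a s a \<le> ennreal K" if as: "a \<in> {t..t + r}" "s \<in> {t..t + r}" for a s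
  proof (cases "(a, s, a) = (t, t, t)")
    case True
    then show ?thesis using K by simp
  next
    case False
    have "dist (a, s, a) (t, t, t) \<le> dist a t + dist (s, a) (t, t)"
      unfolding dist_Pair_Pair by (intro sqrt_sum_squares_le_sum) auto
    also have "dist (s, a) (t, t) \<le> dist s t + dist a t"
      unfolding dist_Pair_Pair by (intro sqrt_sum_squares_le_sum) auto
    also have "dist a t + (dist s t + dist a t) \<le> 3 * (e / 4)"
      using as r by (simp add: dist_real_def)
    also have "\<dots> < e" using e by simp
    finally show ?thesis using eE[of "(a, s, a)"] False as sub by (auto simp: subset_iff)
  qed
  moreover have "0 \<le> K" by (simp add: K_def)
  ultimately show thesis using that r(1) sub by blast
qed

section \<open>The lower bound\<close>

theorem corollary2p5:
  fixes \<Theta> :: "real set"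
    and M :: "'a measure"
    and f :: "'a \<Rightarrow> real \<Rightarrow> real"
    and D :: "nat \<Rightarrow> 'a \<Rightarrow> real \<Rightarrow> real"
    and m0 m :: nat
    and G0 :: "real pmf"
    and \<theta> :: "nat \<Rightarrow> real"
    and T :: "nat \<Rightarrow> (nat \<Rightarrow> 'a) \<Rightarrow> real pmf"
    and \<epsilon> :: real
  assumes "compact \<Theta>" and "interior \<Theta> \<noteq> {}"
    and "sigma_finite_measure M"
    and "density_family \<Theta> M f"
    and "1 \<le> m0" and "m0 \<le> m"
    and "G0 \<in> mixing \<Theta> m0"
    and "bij_betw \<theta> {1..m0} (set_pmf G0)"
    and "\<theta> m0 \<in> interior \<Theta>"
    and "\<forall>p\<in>{1..2 * (m - m0 + 1)}. \<forall>q\<in>{1..4::nat}. pq_smooth \<Theta> M f D p (real q)"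
    and "(\<integral>\<^sup>+x. ennreal \<bar>D (2 * (m - m0) + 1) x (\<theta> m0)\<bar> \<partial>M) > 0"
    and "\<forall>n\<ge>1. estimator \<Theta> M m n (T n)"
    and "\<epsilon> > 0"
  shows "liminf (\<lambda>n.
           SUP G1 \<in> {G \<in> mixing \<Theta> m.
                        W G G0 < real n powr (- 1 / (4 * (real m - real m0) + 2) + \<epsilon>)}.
             ennreal (real n powr (1 / (4 * (real m - real m0) + 2))) *
             (\<integral>\<^sup>+X. ennreal (W G1 (T n X)) \<partial>sample_law M f G1 n)) > 0"
proof -
  define d where "d = m - m0"
  define k where "k = Suc (2 * d)"
  define \<alpha> where "\<alpha> = 1 / (2 * real k)"
  define t where "t = \<theta> m0"
  have \<alpha>: "1 / (4 * (real m - real m0) + 2) = \<alpha>" "- 1 / (4 * (real m - real m0) + 2) + \<epsilon> = \<epsilon> - \<alpha>"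
    using \<open>m0 \<le> m\<close> by (simp_all add: \<alpha>_def k_def d_def of_nat_diff algebra_simps)
  have m: "m0 + d = m" using \<open>m0 \<le> m\<close> by (simp add: d_def)
  have tG: "t \<in> set_pmf G0"
    using bij_betwE[OF assms(8)] \<open>1 \<le> m0\<close> by (auto simp: t_def)
  have fin: "finite (set_pmf G0)" and sub: "set_pmf G0 \<subseteq> \<Theta>"
    using assms(7) by (auto simp: mixing_def)
  \<comment> \<open>Order \<open>k\<close> supplies the moment bound. Order \<open>Suc k\<close>,
    which equals 2 (m - m0 + 1), supplies the derivative that makes \<open>D k x\<close>
    continuous.\<close>
  have smooth: "pq_smooth \<Theta> M f D k 2" and smooth': "pq_smooth \<Theta> M f D (Suc k) 2"
    using assms(10)[rule_format, of k 2] assms(10)[rule_format, of "Suc k" 2] by (auto simp: k_def d_def)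
  have der: "theta_derivs \<Theta> M f D (Suc k)"
    using smooth' by (simp add: pq_smooth_def)
  have meas: "\<And>s. s \<in> \<Theta> \<Longrightarrow> (\<lambda>x. D k x s) \<in> borel_measurable M"
    using smooth by (simp add: pq_smooth_def)
  obtain r K where r: "0 < r" "{t..t + r} \<subseteq> \<Theta>" and K: "0 \<le> K"
    "\<And>a s. a \<in> {t..t + r} \<Longrightarrow> s \<in> {t..t + r} \<Longrightarrow> E_pq M f D k 2 a s a \<le> ennreal K"
    using E_pq_bounded_near_diagonal[OF smooth] assms(9) unfolding t_def by metis
  define C where "C = real (Suc k) * (real k)\<^sup>2 * K"
  have C: "0 \<le> C" using K(1) by (simp add: C_def)
  \<comment> \<open>Chosen so that n C h^(2 k) = C c0^(2 k) <= 1/2, the budget of the two-point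
    bound. The \<open>+ 1\<close> avoids dividing by 0 when \<open>K = 0\<close>.\<close>
  define c0 where "c0 = (1 / (2 * (C + 1))) powr \<alpha>"
  have c0: "0 < c0" using C by (simp add: c0_def)
  have powr_pow: "(x powr \<alpha>) ^ (2 * k) = x" if "0 < x" for x
  proof -
    have "\<alpha> * real (2 * k) = 1" by (simp add: \<alpha>_def k_def)
    then show ?thesis using that by (simp only: powr_realpow[symmetric] powr_gt_zero powr_powr powr_one less_imp_le)
  qed
  have Cc0: "C * c0 ^ (2 * k) \<le> 1 / 2"
  proof -
    have "c0 ^ (2 * k) = 1 / (2 * (C + 1))"
      using C powr_pow[of "1 / (2 * (C + 1))"] by (simp add: c0_def)
    moreover have "C * (1 / (2 * (C + 1))) \<le> 1 / 2" using C by (simp add: field_simps)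
    ultimately show ?thesis by (simp only:)
  qed
  define h where "h n = c0 * real n powr (- \<alpha>)" for n
  define c where "c = pmf G0 t / 2 ^ (2 * d)"
  have c: "0 < c" using tG by (simp add: c_def pmf_positive)
  have \<alpha>pos: "0 < \<alpha>" by (simp add: \<alpha>_def k_def)
  \<comment> \<open>Room to the right of \<open>t\<close>: up to the next atom of \<open>G0\<close>,
    and at most \<open>r\<close>, so that the displaced points stay where \<open>E_pq\<close> is
    bounded.\<close>
  define gap where "gap = Min (insert r ((\<lambda>s. s - t) ` {s \<in> set_pmf G0. t < s}))"
  have gap: "0 < gap" "gap \<le> r" "\<And>s. s \<in> set_pmf G0 \<Longrightarrow> t < s \<Longrightarrow> t + gap \<le> s"
  proof -
    show "0 < gap" using r fin by (auto simp: gap_def)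
    show "gap \<le> r" using fin by (simp add: gap_def)
    fix s assume "s \<in> set_pmf G0" "t < s"
    then have "gap \<le> s - t" unfolding gap_def using fin by (intro Min_le) auto
    then show "t + gap \<le> s" by simp
  qed
  have "((\<lambda>n. real k * (c0 * real n powr (- \<alpha>))) \<longlongrightarrow> real k * (c0 * 0)) sequentially"
    by (intro tendsto_mult tendsto_const tendsto_neg_powr filterlim_real_sequentially) (use \<alpha>pos in simp)
  then have ev1: "\<forall>\<^sub>F n in sequentially. real k * h n < gap"
    using gap(1) by (intro order_tendstoD(2)) (auto simp: h_def)
  \<comment> \<open>The mixtures are within k h = k c0 n^(-\<alpha>) of \<open>G0\<close>. This is
    below the radius n^(\<epsilon> - \<alpha>) once k c0 n^(-\<epsilon>) < 1, so \<epsilon> > 0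
    absorbs the constant.\<close>
  have "((\<lambda>n. real k * c0 * real n powr (- \<epsilon>)) \<longlongrightarrow> real k * c0 * 0) sequentially"
    by (intro tendsto_mult tendsto_const tendsto_neg_powr filterlim_real_sequentially) (use \<open>0 < \<epsilon>\<close> in simp)
  then have ev2: "\<forall>\<^sub>F n in sequentially. real k * c0 * real n powr (- \<epsilon>) < 1"
    by (intro order_tendstoD(2)) auto
  let ?V = "\<lambda>n. {G \<in> mixing \<Theta> m. W G G0 < real n powr (\<epsilon> - \<alpha>)}"
  let ?R = "\<lambda>n G. ennreal (real n powr \<alpha>) * (\<integral>\<^sup>+X. ennreal (W G (T n X)) \<partial>sample_law M f G n)"
  have "\<forall>\<^sub>F n in sequentially. ennreal (c * c0 / 8) \<le> (SUP G \<in> ?V n. ?R n G)"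
    using ev1 ev2 eventually_ge_at_top[of 1]
  proof eventually_elim
    case (elim n)
    have n: "0 < real n" using elim(3) by simp
    have h: "0 < h n" using c0 n by (simp add: h_def)
    let ?P = "\<lambda>b. split_atom t (h n) (parity_pmf d b) G0"
    have I: "{t..t + real k * h n} \<subseteq> {t..t + r}" using elim(1) gap(2) by auto
    have mix: "?P b \<in> mixing \<Theta> m" for b
      unfolding m[symmetric]
    proof (rule split_parity_in_mixing[OF assms(7) tG h \<open>1 \<le> m0\<close>], unfold k_def[symmetric])
      show "{t..t + real k * h n} \<subseteq> \<Theta>" using I r(2) by blast
      show "t + real k * h n < s" if "s \<in> set_pmf G0" "t < s" for s
        using gap(3)[OF that] elim(1) by simp
    qed
    then have finP: "finite (set_pmf (?P b))" and subP: "set_pmf (?P b) \<subseteq> \<Theta>" for b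
      by (auto simp: mixing_def)
    have V: "?P b \<in> ?V n" for b
    proof -
      have "W (?P b) G0 \<le> real k * h n"
        using W_split_parity_le[OF fin h tG] by (simp add: k_def)
      also have "\<dots> = real k * c0 * real n powr (- \<alpha>)" by (simp add: h_def)
      also have "\<dots> < real n powr \<epsilon> * real n powr (- \<alpha>)"
        using elim(2) n by (intro mult_strict_right_mono) (simp_all add: powr_minus_divide pos_divide_less_eq)
      also have "\<dots> = real n powr (\<epsilon> - \<alpha>)" by (simp add: powr_add[symmetric])
      finally show ?thesis using mix by simp
    qed
    have nh: "real n * (C * h n ^ (2 * k)) \<le> 1 / 2"
    proof -
      have "(real n powr (- \<alpha>)) ^ (2 * k) = 1 / real n"
        using n powr_pow[OF n] by (simp add: powr_minus_divide power_one_over)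
      then have "real n * (C * h n ^ (2 * k)) = C * c0 ^ (2 * k)"
        using n by (simp add: h_def power_mult_distrib)
      then show ?thesis using Cc0 by (simp only:)
    qed
    have est: "estimator \<Theta> M m n (T n)" using assms(12) elim(3) by simp
    have bT: "bounded (set_pmf (T n X))" if "X \<in> space (PiM {..<n} (\<lambda>_. M))" for X
      using est that by (auto simp: estimator_def mixing_le_def mixing_def intro!: finite_imp_bounded)
    have mW: "(\<lambda>X. W P (T n X)) \<in> borel_measurable (PiM {..<n} (\<lambda>_. M))" for P
      using est by (intro borel_measurable_W) (simp add: estimator_def)
    let ?Int = "\<lambda>b. \<integral>\<^sup>+X. ennreal (W (?P b) (T n X)) \<partial>sample_law M f (?P b) n"
    have "ennreal (c * h n / 4) \<le> ?Int True + ?Int False"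
      unfolding sample_law_def
    proof (rule le_cam_two_points[OF \<open>sigma_finite_measure M\<close>])
      show "(\<integral>\<^sup>+x. ennreal ((mix_density f x (?P True) - mix_density f x (?P False))\<^sup>2
          / (mix_density f x (?P True) + mix_density f x (?P False))) \<partial>M) \<le> ennreal (C * h n ^ (2 * k))"
        unfolding C_def k_def
        using I r K h sub fin der meas
        by (intro nn_integral_split_parity_le[OF assms(3,4)]) (auto simp: k_def)
      show "0 \<le> C * h n ^ (2 * k)" using C h by simp
      show "real n * (C * h n ^ (2 * k)) \<le> 1 / 2" by (rule nh)
      \<comment> \<open>No estimate can be close to both mixtures, which are at least
        \<open>c * h n\<close> apart.\<close>
      show "c * h n \<le> W (?P True) (T n X) + W (?P False) (T n X)"
        if X: "X \<in> space (PiM {..<n} (\<lambda>_. M))" for X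
        using W_split_parity_ge[OF fin h, of t d]
          W_triangle[OF finite_imp_bounded[OF finP] finite_imp_bounded[OF finP] bT[OF X], of True False]
        unfolding c_def by linarith
      show "0 \<le> c * h n" using c h by simp
    qed (use mix_density_is_density[OF assms(4) finP subP] mW W_nonneg in auto)
    then have "ennreal (real n powr \<alpha>) * ennreal (c * h n / 4) \<le> ?R n (?P True) + ?R n (?P False)"
      by (simp add: distrib_left[symmetric] mult_left_mono)
    also have "\<dots> \<le> (SUP G \<in> ?V n. ?R n G) + (SUP G \<in> ?V n. ?R n G)"
      by (intro add_mono SUP_upper V)
    \<comment> \<open>The rate cancels the decay of \<open>h n\<close>. The constant is halved
      because only the sum of the two risks is bounded below.\<close>
    also have "ennreal (real n powr \<alpha>) * ennreal (c * h n / 4) = ennreal (c * c0 / 8) + ennreal (c * c0 / 8)"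
    proof -
      have "ennreal (real n powr \<alpha>) * ennreal (c * h n / 4) = ennreal (real n powr \<alpha> * (c * h n / 4))"
        by (rule ennreal_mult'[symmetric]) simp
      also have "real n powr \<alpha> * (c * h n / 4) = c * c0 / 8 + c * c0 / 8"
        using n by (simp add: h_def powr_minus field_simps)
      also have "ennreal \<dots> = ennreal (c * c0 / 8) + ennreal (c * c0 / 8)"
        using c c0 by (intro ennreal_plus) simp_all
      finally show ?thesis .
    qed
    \<comment> \<open>A supremum below \<open>c * c0 / 8\<close> would make its double smaller than
      the double of that constant.\<close>
    finally show ?case by (meson add_strict_mono not_le)
  qed
  then have "ennreal (c * c0 / 8) \<le> liminf (\<lambda>n. SUP G \<in> ?V n. ?R n G)"
    by (rule Liminf_bounded)
  moreover have "0 < ennreal (c * c0 / 8)" using c c0 by simp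
  ultimately show ?thesis unfolding \<alpha> by (rule order.strict_trans2[rotated])
qed

end
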